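(* Let $\alpha>3$, $L>0$, $0<s<L^{-1}$ and $p>2$ be real numbers, and let $d\ge1$ be an integer. (Upper bound.) Let $F:\mathbb R^d\to\mathbb R$ be convex and differentiable with $L$-Lipschitz gradient, attaining its minimum $F^*$. Then for every initialization $x_0,x_1\in\mathbb R^d$, the CD orbit $(x_n)$ of $F$ with damping $\alpha$ and step $s$ satisfies $$F(x_n)-F^*=O\bigl(n^{-2p/(p-2)}\bigr)\qquad(n\to\infty)$$ (with the constant and the starting index of the bound allowed to depend on $F$ and the initialization) under either of the following conditions: (i) $F$ has a unique minimizer and satisfies $H(\beta)$ and $L(p)$, for some real $\beta$ with $2<\beta\le p$ and $\alpha\ge\frac{\beta+2}{\beta-2}$; (ii) $F$ satisfies $L_{\mathrm{set}}(p)$ and $\alpha>5+\frac{8}{p-2}$. (Sharpness.) In each regime the rate is attained. That is, for all real numbers $\alpha>3$, $L>0$, $0<s<L^{-1}$, $p>2$, every integer $d\ge1$ and every real $\beta$ with $2<\beta\le p$ and $\alpha\ge\frac{\beta+2}{\beta-2}$ (regime (i)), respectively for all real numbers $\alpha>3$, $L>0$, $0<s<L^{-1}$, $p>2$ and every integer $d\ge1$ with $\alpha>5+\frac{8}{p-2}$ (regime (ii)), there exist a coercive, convex, differentiable $F:\mathbb R^d\to\mathbb R$ with $L$-Lipschitz gradient and a unique minimizer, satisfying $H(\beta)$ and $L(p)$ in regime (i), respectively $L_{\mathrm{set}}(p)$ in regime (ii), an initialization $x_0,x_1\in\mathbb R^d$, and a constant $D>0$ such that the CD orbit with damping $\alpha$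 and step $s$ satisfies $$F(x_n)-F^*\sim D\,n^{-2p/(p-2)}\qquad(n\to\infty).$$ Consequently, in each regime and for each such choice of parameters, no common divergent gain improves the rate: there is no positive nondecreasing sequence $G(n)\to\infty$ such that $F(x_n)-F^*=O\bigl(n^{-2p/(p-2)}/G(n)\bigr)$ for every $F$ in the regime and every initialization (even with constant and starting index depending on $F$ and the initialization).
   Context: Norms and inner products on $\mathbb R^d$ are Euclidean. $F^*=\min F$, and $X^*$ is the set of minimizers of $F$; $\operatorname{dist}(x,X^* )$ is the Euclidean distance from $x$ to $X^*$. $F$ is coercive if $F(x)\to\infty$ as $\|x\|\to\infty$. The gradient is $L$-Lipschitz if $\|\nabla F(x)-\nabla F(z)\|\le L\|x-z\|$ for all $x,z$. $a_n\sim b_n$ means $a_n/b_n\to1$. CD (Chambolle--Dossal) iteration: for differentiable $F:\mathbb R^d\to\mathbb R$, damping $\alpha$, step $s$ and initialization $x_0,x_1\in\mathbb R^d$, the CD orbit $(x_n)$ is defined by $$\beta_n=\frac{n-1}{n+\alpha-1},\qquad y_n=x_n+\beta_n(x_n-x_{n-1}),\qquad x_{n+1}=y_n-s\nabla F(y_n),\qquad n\ge1.$$ (The exponent $\beta$ in the condition $H(\beta)$ is unrelated to the coefficients $\beta_n$.) Local conditions: $H(\beta)$ (for $F$ with unique minimizer $x^*$, $\beta>2$): there is $\eta>0$ such that $F(x)-F^*\le\frac1\beta\langle\nabla F(x),x-x^*\rangle$ for all $x$ with $\|x-x^*\|\le\eta$. $L(p)$ (for $F$ with unique minimizer $x^*$,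 $p>2$): there are $K,\varepsilon>0$ such that $F(x)-F^*\ge K\|x-x^*\|^p$ for all $x$ with $\|x-x^*\|\le\varepsilon$. $L_{\mathrm{set}}(p)$ (minimizer not necessarily unique, $p>2$): there are $K,\varepsilon>0$ such that $F(x)-F^*\ge K\operatorname{dist}(x,X^* )^p$ for all $x$ with $\operatorname{dist}(x,X^* )\le\varepsilon$. *)

theory Defs
  imports "HOL-Analysis.Analysis" "HOL-Library.Landau_Symbols"
begin

definition gradient :: "('a::real_inner \<Rightarrow> real) \<Rightarrow> 'a \<Rightarrow> 'a" where
  "gradient F x = (THE g. GDERIV F x :> g)"

lemma gradient_eqI:
  assumes "GDERIV F x :> g"
  shows "gradient F x = g"
  unfolding gradient_def
proof (rule the_equality)
  fix h assume "GDERIV F x :> h"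
  then have "(\<lambda>v. inner v h) = (\<lambda>v. inner v g)"
    using assms has_derivative_unique unfolding gderiv_def by blast
  then have "inner (h - g) h = inner (h - g) g"
    by meson
  then have "inner (h - g) (h - g) = 0"
    by (simp add: inner_diff_right)
  then show "h = g"
    by simp
qed (fact assms)

lemma GDERIV_gradient:
  fixes F :: "'a::euclidean_space \<Rightarrow> real"
  assumes "F differentiable (at x)"
  shows "GDERIV F x :> gradient F x"
proof -
  obtain F' where F': "(F has_derivative F') (at x)"
    using assms by (auto simp: differentiable_def)
  then have "linear F'"
    by (rule has_derivative_linear)
  have "F' h = inner h (\<Sum>b\<in>Basis. F' b *\<^sub>R b)" for h
  proof -
    have "F' h = F' (\<Sum>b\<in>Basis. inner h b *\<^sub>R b)"
      by (simp only: euclidean_representation)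
    also have "\<dots> = (\<Sum>b\<in>Basis. inner h b * F' b)"
      by (simp only: linear_sum [OF \<open>linear F'\<close>] linear_cmul [OF \<open>linear F'\<close>] real_scaleR_def)
    also have "\<dots> = inner h (\<Sum>b\<in>Basis. F' b *\<^sub>R b)"
      by (simp only: inner_sum_right inner_scaleR_right mult.commute)
    finally show ?thesis .
  qed
  then have "(\<lambda>h. inner h (\<Sum>b\<in>Basis. F' b *\<^sub>R b)) = F'"
    by (intro ext) (rule sym)
  with F' have "GDERIV F x :> (\<Sum>b\<in>Basis. F' b *\<^sub>R b)"
    by (simp add: gderiv_def)
  then show ?thesis
    using gradient_eqI by metis
qed

definition min_value :: "('a \<Rightarrow> real) \<Rightarrow> real" where
  "min_value F = (LEAST v. v \<in> range F)"

definition minimizers :: "('a \<Rightarrow> real) \<Rightarrow> 'a set" where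
  "minimizers F = {x. \<forall>z. F x \<le> F z}"

definition coercive :: "('a::real_normed_vector \<Rightarrow> real) \<Rightarrow> bool" where
  "coercive F \<longleftrightarrow> filterlim F at_top at_infinity"

definition convex_smooth :: "real \<Rightarrow> ('a::euclidean_space \<Rightarrow> real) \<Rightarrow> bool" where
  "convex_smooth L F \<longleftrightarrow>
     convex_on UNIV F \<and> (\<forall>x. F differentiable (at x)) \<and> L-lipschitz_on UNIV (gradient F)"

text \<open>In the next two conditions \<open>xs\<close> stands for the unique minimizer of \<open>F\<close>;
  uniqueness itself is imposed where they are used.\<close>

definition cond_H :: "real \<Rightarrow> ('a::euclidean_space \<Rightarrow> real) \<Rightarrow> 'a \<Rightarrow> bool" where
  "cond_H \<beta> F xs \<longleftrightarrow>
     (\<exists>\<eta>>0. \<forall>x. norm (x - xs) \<le> \<eta> \<longrightarrow>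
        F x - min_value F \<le> 1 / \<beta> * inner (gradient F x) (x - xs))"

definition cond_L :: "real \<Rightarrow> ('a::euclidean_space \<Rightarrow> real) \<Rightarrow> 'a \<Rightarrow> bool" where
  "cond_L p F xs \<longleftrightarrow>
     (\<exists>K>0. \<exists>\<epsilon>>0. \<forall>x. norm (x - xs) \<le> \<epsilon> \<longrightarrow>
        F x - min_value F \<ge> K * norm (x - xs) powr p)"

definition cond_Lset :: "real \<Rightarrow> ('a::euclidean_space \<Rightarrow> real) \<Rightarrow> bool" where
  "cond_Lset p F \<longleftrightarrow>
     (\<exists>K>0. \<exists>\<epsilon>>0. \<forall>x. infdist x (minimizers F) \<le> \<epsilon> \<longrightarrow>
        F x - min_value F \<ge> K * infdist x (minimizers F) powr p)"

definition regime_unique :: "real \<Rightarrow> real \<Rightarrow> real \<Rightarrow> ('a::euclidean_space \<Rightarrow> real) \<Rightarrow> bool" where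
  "regime_unique L p \<beta> F \<longleftrightarrow>
     convex_smooth L F \<and> (\<exists>xs. minimizers F = {xs} \<and> cond_H \<beta> F xs \<and> cond_L p F xs)"

definition regime_set :: "real \<Rightarrow> real \<Rightarrow> ('a::euclidean_space \<Rightarrow> real) \<Rightarrow> bool" where
  "regime_set L p F \<longleftrightarrow> convex_smooth L F \<and> minimizers F \<noteq> {} \<and> cond_Lset p F"

definition cd_coeff :: "real \<Rightarrow> nat \<Rightarrow> real" where
  "cd_coeff \<alpha> n = (real n - 1) / (real n + \<alpha> - 1)"

fun cd_orbit :: "real \<Rightarrow> real \<Rightarrow> ('a::euclidean_space \<Rightarrow> real) \<Rightarrow> 'a \<Rightarrow> 'a \<Rightarrow> nat \<Rightarrow> 'a" where
  "cd_orbit \<alpha> s F x0 x1 0 = x0"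
| "cd_orbit \<alpha> s F x0 x1 (Suc 0) = x1"
| "cd_orbit \<alpha> s F x0 x1 (Suc (Suc n)) =
     (let x' = cd_orbit \<alpha> s F x0 x1 n;
          x = cd_orbit \<alpha> s F x0 x1 (Suc n);
          y = x + cd_coeff \<alpha> (Suc n) *\<^sub>R (x - x')
      in y - s *\<^sub>R gradient F y)"

definition cd_gap :: "real \<Rightarrow> real \<Rightarrow> ('a::euclidean_space \<Rightarrow> real) \<Rightarrow> 'a \<Rightarrow> 'a \<Rightarrow> nat \<Rightarrow> real" where
  "cd_gap \<alpha> s F x0 x1 n = F (cd_orbit \<alpha> s F x0 x1 n) - min_value F"

definition cd_rate :: "real \<Rightarrow> nat \<Rightarrow> real" where
  "cd_rate p n = real n powr (- (2 * p) / (p - 2))"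

definition divergent_gain :: "(nat \<Rightarrow> real) \<Rightarrow> bool" where
  "divergent_gain G \<longleftrightarrow> (\<forall>n. G n > 0) \<and> mono G \<and> filterlim G at_top sequentially"

end

theory Submission
  imports Defs "HOL-Real_Asymp.Real_Asymp"
begin

text \<open>Upper bound. Write \<open>W n\<close> for the gap, \<open>u n = x n - z n\<close> with a minimizer \<open>z n\<close>, \<open>\<mu> = \<alpha> - 1 - \<theta>\<close> and
\<open>v n = \<theta> * u n + (n - 1) * (x n - x (n - 1))\<close>. The energy is, to leading order, the sum of \<open>s * n ^ 2 * W n\<close> and
\<open>B n = norm (v n) ^ 2 / 2 - \<theta> * \<mu> / 2 * norm (u n) ^ 2\<close>, and it is multiplied by a weight \<open>n powr q\<close>; for
\<open>q = 2 * \<theta>\<close> this imitates the natural energy of the rescaled orbit \<open>n powr \<theta> * u n\<close>. It decreases along the iteration up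
to errors bounded by multiples of \<open>norm (u n) ^ 2 / n\<close> (\<open>inertial_step_scaled\<close>). The energy may be negative, but
only through the term in \<open>norm (u n) ^ 2\<close>, which the growth condition bounds by a multiple of \<open>W n powr (2 / p)\<close>. This
is sublinear in \<open>W n\<close>, and a bootstrap gives the rate (\<open>decay_of_weighted_energy\<close>). In the regime of a unique
minimizer the flatness exponent \<open>\<beta>\<close> permits \<open>\<theta> = 2 / (\<beta> - 2)\<close> and \<open>q = 2 * \<theta>\<close>. In the other regime only convexity is
available and the reference point has to follow the projection of \<open>x n\<close>; with \<open>\<theta> = (\<alpha> - 1) / 2\<close> this motion only
decreases the energy. That the values converge to the minimum at all, so that the local
conditions can be used, is the classical Lyapunov argument (\<open>cd_gap_tendsto_0\<close>).

Sharpness. One function serves both regimes and all \<open>\<beta> \<le> p\<close>. Instead of studying the orbits of a given function,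
the orbit \<open>x n = (n + \<alpha> - 1) powr (- \<theta>)\<close> with \<open>\<theta> = 2 / (p - 2)\<close> is prescribed for large \<open>n\<close> and the derivative of a
one-dimensional function is read off from the iteration (\<open>one_dimensional_inverse_design\<close>). Near \<open>0\<close> this
derivative behaves like a multiple of the power \<open>p - 1\<close>, and the first correction has the sign required by the
flatness condition with exponent \<open>p\<close> (\<open>cd_tail_properties\<close>). An initial phase under constant force leads to the
tail. Summing the function over the coordinates gives the example in every dimension, and an exact asymptotic rate
excludes any common gain.\<close>

section \<open>Convex functions with Lipschitz gradient\<close>

lemma DERIV_along_line:
  fixes F :: "'a::euclidean_space \<Rightarrow> real"
  assumes "F differentiable (at (x + t *\<^sub>R v))"
  shows "((\<lambda>t. F (x + t *\<^sub>R v)) has_real_derivative inner (gradient F (x + t *\<^sub>R v)) v) (at t)"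
proof -
  have "(F has_derivative (\<lambda>h. inner h (gradient F (x + t *\<^sub>R v)))) (at (x + t *\<^sub>R v))"
    using GDERIV_gradient[OF assms] by (simp add: gderiv_def)
  then have "((\<lambda>t. F (x + t *\<^sub>R v)) has_derivative
      (\<lambda>h. inner (h *\<^sub>R v) (gradient F (x + t *\<^sub>R v)))) (at t)"
    by (rule has_derivative_compose[rotated, unfolded o_def])
       (auto intro!: derivative_eq_intros)
  then show ?thesis
    by (simp add: has_field_derivative_def inner_commute[of v] mult_commute_abs)
qed

lemma convex_gradient_ineq:
  fixes F :: "'a::euclidean_space \<Rightarrow> real"
  assumes "convex_on UNIV F" and "F differentiable (at x)"
  shows "F x + inner (gradient F x) (z - x) \<le> F z"
proof -
  have "convex_on UNIV (\<lambda>t. F (x + t *\<^sub>R (z - x)))"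
  proof (rule convex_onI)
    fix t a b :: real assume t: "0 < t" "t < 1"
    have "x + ((1 - t) *\<^sub>R a + t *\<^sub>R b) *\<^sub>R (z - x)
        = (1 - t) *\<^sub>R (x + a *\<^sub>R (z - x)) + t *\<^sub>R (x + b *\<^sub>R (z - x))"
      by (simp add: algebra_simps)
    then show "F (x + ((1 - t) *\<^sub>R a + t *\<^sub>R b) *\<^sub>R (z - x))
        \<le> (1 - t) * F (x + a *\<^sub>R (z - x)) + t * F (x + b *\<^sub>R (z - x))"
      using convex_onD[OF assms(1), of t "x + a *\<^sub>R (z - x)" "x + b *\<^sub>R (z - x)"] t by simp
  qed simp
  from convex_on_imp_above_tangent[OF this, of 0 1 "inner (gradient F x) (z - x)"]
    DERIV_along_line[of F x 0 "z - x"] assms(2)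
  show ?thesis by simp
qed

text \<open>The factor \<open>1 / 2\<close>, rather than the \<open>1 - s * L\<close> that the gradient inequality at the new point gives, is what cancels the
square of the gradient in the energy below; it comes from integrating the Lipschitz bound along the step.\<close>

lemma gradient_descent_ineq:
  fixes F :: "'a::euclidean_space \<Rightarrow> real"
  assumes F: "convex_smooth L F" and s: "0 \<le> s" "s * L \<le> 1"
  shows "F (y - s *\<^sub>R gradient F y) \<le> F y - s / 2 * (norm (gradient F y))\<^sup>2"
proof -
  define g where "g = gradient F y"
  define \<phi> where "\<phi> t = F (y + t *\<^sub>R (- g)) + t * (norm g)\<^sup>2 - t\<^sup>2 / 2 * L * (norm g)\<^sup>2" for t
  have diff: "F differentiable (at x)" for x
    using F by (simp add: convex_smooth_def)
  have lip: "norm (gradient F x - gradient F z) \<le> L * norm (x - z)" for x z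
    using F by (auto simp: convex_smooth_def lipschitz_on_def dist_norm)
  have "\<phi> 0 \<ge> \<phi> s"
  proof (rule DERIV_nonpos_imp_nonincreasing[OF s(1)])
    fix t assume t: "0 \<le> t" "t \<le> s"
    let ?G = "gradient F (y + t *\<^sub>R (- g))"
    have "(\<phi> has_real_derivative (inner ?G (- g) + (norm g)\<^sup>2 - t * L * (norm g)\<^sup>2)) (at t)"
      unfolding \<phi>_def by (rule derivative_eq_intros DERIV_along_line diff refl | simp)+
    moreover have "inner ?G (- g) + (norm g)\<^sup>2 = inner (g - ?G) g"
      by (simp add: inner_diff_left power2_norm_eq_inner)
    moreover have "inner (g - ?G) g \<le> norm (g - ?G) * norm g"
      by (rule norm_cauchy_schwarz)
    moreover have "norm (g - ?G) \<le> t * L * norm g"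
      using lip[of y "y + t *\<^sub>R (- g)"] t by (simp add: g_def algebra_simps)
    then have "norm (g - ?G) * norm g \<le> t * L * (norm g)\<^sup>2"
      by (simp add: power2_eq_square mult_right_mono flip: mult.assoc)
    ultimately show "\<exists>D. DERIV \<phi> t :> D \<and> D \<le> 0" by force
  qed
  then have "F (y - s *\<^sub>R g) \<le> F y - s * (norm g)\<^sup>2 + (s * L) * (s / 2 * (norm g)\<^sup>2)"
    by (simp add: \<phi>_def power2_eq_square algebra_simps)
  also have "\<dots> \<le> F y - s * (norm g)\<^sup>2 + 1 * (s / 2 * (norm g)\<^sup>2)"
    using s by (intro add_left_mono mult_right_mono) auto
  finally show ?thesis by (simp add: g_def)
qed

section \<open>Energy inequalities for one inertial step\<close>

text \<open>The computation behind every energy estimate for the iteration. Since \<open>N (y - x) = (n - 1) (x - x')\<close>, the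
vector \<open>v0\<close> equals \<open>\<theta> (y - z) + (N - \<theta>) (y - x)\<close>, so its inner product with the gradient at \<open>y\<close> is bounded
by the inequality \<open>H\<close> towards \<open>z\<close> and by convexity towards \<open>x\<close>, without any error term. The remaining
square of the gradient is paid for by the descent inequality. The number \<open>b\<close> is the exponent of the
flatness condition, or \<open>1\<close> when only convexity is used.\<close>

lemma inertial_step_energy:
  fixes x' x z y x'' g :: "'a::real_inner" and n \<alpha> \<theta> s :: real
  defines "N \<equiv> n + \<alpha> - 1" and "\<mu> \<equiv> \<alpha> - 1 - \<theta>"
  defines "v0 \<equiv> \<theta> *\<^sub>R (x - z) + (n - 1) *\<^sub>R (x - x')" and "v1 \<equiv> \<theta> *\<^sub>R (x'' - z) + n *\<^sub>R (x'' - x)"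
  assumes N: "N > 0" and lam: "0 \<le> \<theta>" "\<theta> \<le> N" and s: "s \<ge> 0"
    and y: "y = x + ((n - 1) / N) *\<^sub>R (x - x')" and x'': "x'' = y - s *\<^sub>R g"
    and H: "b * Wy \<le> inner g (y - z)" and conv: "Wy - W0 \<le> inner g (y - x)"
    and desc: "W1 \<le> Wy - s / 2 * (norm g)\<^sup>2"
  shows "s * N\<^sup>2 * W1 + (norm v1)\<^sup>2 / 2 \<le> s * N * (N - \<theta>) * W0 + (norm v0)\<^sup>2 / 2
    - s * N * \<theta> * (b - 1) * Wy - \<mu> * inner v1 (x'' - x) - \<mu>\<^sup>2 / 2 * (norm (x'' - x))\<^sup>2"
proof -
  define d where "d = x'' - x"
  have Ny: "(n - 1) *\<^sub>R (x - x') = N *\<^sub>R (y - x)"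
    using N by (simp add: y)
  have sg: "s *\<^sub>R g = (y - x) - d"
    by (simp add: d_def x'')
  have v0': "v0 = \<theta> *\<^sub>R (x - z) + N *\<^sub>R (y - x)"
    by (simp only: v0_def Ny)
  then have v0: "v0 = \<theta> *\<^sub>R (y - z) + (N - \<theta>) *\<^sub>R (y - x)"
    by (simp add: algebra_simps)
  note v0'
  moreover have "v1 = \<theta> *\<^sub>R (x - z) + (\<theta> + n) *\<^sub>R d"
    by (simp add: v1_def d_def algebra_simps)
  moreover have "N *\<^sub>R d = (\<theta> + n) *\<^sub>R d + \<mu> *\<^sub>R d"
    by (simp add: N_def \<mu>_def flip: scaleR_add_left)
  ultimately have "v0 = v1 + \<mu> *\<^sub>R d + N *\<^sub>R ((y - x) - d)"
    by (simp add: scaleR_diff_right)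
  then have v01: "v1 = v0 - \<mu> *\<^sub>R d - (s * N) *\<^sub>R g"
    by (simp add: sg[symmetric] mult.commute)
  have "(norm v1)\<^sup>2 - (norm v0)\<^sup>2 = - 2 * \<mu> * inner v1 d - \<mu>\<^sup>2 * (norm d)\<^sup>2
      - 2 * s * N * inner v0 g + s\<^sup>2 * N\<^sup>2 * (norm g)\<^sup>2"
    unfolding v01 power2_norm_eq_inner
    by (simp add: inner_diff_left inner_diff_right inner_commute algebra_simps power2_eq_square)
  moreover have "inner v0 g \<ge> \<theta> * (b * Wy) + (N - \<theta>) * (Wy - W0)"
    unfolding v0 inner_add_left inner_scaleR_left
    using lam H conv by (intro add_mono mult_left_mono) (auto simp: inner_commute)
  then have "s * N * inner v0 g \<ge> s * N * (\<theta> * (b * Wy) + (N - \<theta>) * (Wy - W0))"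
    using s N by (intro mult_left_mono) auto
  moreover have "s * N\<^sup>2 * W1 \<le> s * N\<^sup>2 * (Wy - s / 2 * (norm g)\<^sup>2)"
    using s desc by (intro mult_left_mono) auto
  ultimately show ?thesis
    unfolding d_def[symmetric] by (simp add: algebra_simps power2_eq_square)
qed

text \<open>Adding a positive multiple of the squared distance to \<open>z\<close> completes the terms in \<open>v1\<close> to a
nonpositive quantity. With \<open>\<theta> = 2\<close> this is the classical Lyapunov function, used here only to know that the values
converge to the minimum, so that the local conditions apply.\<close>

lemma inertial_step_classical:
  fixes x' x z y x'' g :: "'a::real_inner" and n \<alpha> \<theta> s :: real
  defines "N \<equiv> n + \<alpha> - 1" and "\<mu> \<equiv> \<alpha> - 1 - \<theta>"
  defines "v0 \<equiv> \<theta> *\<^sub>R (x - z) + (n - 1) *\<^sub>R (x - x')" and "v1 \<equiv> \<theta> *\<^sub>R (x'' - z) + n *\<^sub>R (x'' - x)"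
  assumes N: "N > 0" and lam: "0 \<le> \<theta>" "\<theta> \<le> N" and s: "s \<ge> 0"
    and y: "y = x + ((n - 1) / N) *\<^sub>R (x - x')" and x'': "x'' = y - s *\<^sub>R g"
    and H: "Wy \<le> inner g (y - z)" and conv: "Wy - W0 \<le> inner g (y - x)"
    and desc: "W1 \<le> Wy - s / 2 * (norm g)\<^sup>2" and n: "n \<ge> 0" and mu: "\<mu> \<ge> 0"
  shows "s * N\<^sup>2 * W1 + (norm v1)\<^sup>2 / 2 + \<theta> * \<mu> / 2 * (norm (x'' - z))\<^sup>2
    \<le> s * N * (N - \<theta>) * W0 + (norm v0)\<^sup>2 / 2 + \<theta> * \<mu> / 2 * (norm (x - z))\<^sup>2"
proof -
  define u where "u = x'' - z"
  define d where "d = x'' - x"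
  have xz: "x - z = u - d" and v1: "v1 = \<theta> *\<^sub>R u + n *\<^sub>R d"
    by (simp_all add: u_def d_def v1_def)
  have "\<mu> * inner v1 d + \<mu>\<^sup>2 / 2 * (norm d)\<^sup>2 - \<theta> * \<mu> / 2 * ((norm u)\<^sup>2 - (norm (u - d))\<^sup>2)
      = \<mu> * n * (norm d)\<^sup>2 + \<mu> * (\<mu> + \<theta>) / 2 * (norm d)\<^sup>2"
    unfolding v1 power2_norm_eq_inner
    by (simp add: inner_diff_left inner_diff_right inner_add_left inner_commute algebra_simps
        power2_eq_square)
  moreover have "\<dots> \<ge> 0"
    using n mu lam by simp
  moreover have "1 * Wy \<le> inner g (y - z)" using H by simp
  from inertial_step_energy[OF N[unfolded N_def] lam[unfolded N_def] s y[unfolded N_def] x'' this conv desc]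
  have "s * N\<^sup>2 * W1 + (norm v1)\<^sup>2 / 2 \<le> s * N * (N - \<theta>) * W0 + (norm v0)\<^sup>2 / 2
      - \<mu> * inner v1 d - \<mu>\<^sup>2 / 2 * (norm d)\<^sup>2"
    by (simp add: N_def \<mu>_def v0_def v1_def d_def)
  ultimately show ?thesis
    unfolding xz u_def[symmetric] by (simp add: algebra_simps)
qed

text \<open>Here the squared distance enters with a minus sign. In continuous time \<open>B\<close> is then, up to the factor
\<open>t powr (2 * \<theta>)\<close>, the natural energy of the rescaled curve \<open>t powr \<theta> * (x - z)\<close>: the terms in \<open>v1\<close> and in the
distance combine to the single multiple \<open>2 * \<theta> / n\<close> of \<open>B1\<close>, and what is left over has a sign because
\<open>\<theta> \<le> \<mu>\<close>.\<close>

lemma inertial_step_scaled: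
  fixes x' x z y x'' g :: "'a::real_inner" and n \<alpha> \<theta> s :: real
  defines "N \<equiv> n + \<alpha> - 1" and "\<mu> \<equiv> \<alpha> - 1 - \<theta>"
  defines "v0 \<equiv> \<theta> *\<^sub>R (x - z) + (n - 1) *\<^sub>R (x - x')" and "v1 \<equiv> \<theta> *\<^sub>R (x'' - z) + n *\<^sub>R (x'' - x)"
  defines "B0 \<equiv> (norm v0)\<^sup>2 / 2 - \<theta> * \<mu> / 2 * (norm (x - z))\<^sup>2"
    and "B1 \<equiv> (norm v1)\<^sup>2 / 2 - \<theta> * \<mu> / 2 * (norm (x'' - z))\<^sup>2"
  assumes N: "N > 0" and lam: "0 \<le> \<theta>" "\<theta> \<le> \<mu>" and s: "s \<ge> 0"
    and y: "y = x + ((n - 1) / N) *\<^sub>R (x - x')" and x'': "x'' = y - s *\<^sub>R g"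
    and H: "b * Wy \<le> inner g (y - z)" and conv: "Wy - W0 \<le> inner g (y - x)"
    and desc: "W1 \<le> Wy - s / 2 * (norm g)\<^sup>2" and n: "n > 0" and b: "b \<ge> 1"
  shows "s * N * (N + \<theta> * (b - 1)) * W1 + (1 + 2 * \<theta> / n) * B1 \<le> s * N * (N - \<theta>) * W0 + B0"
proof -
  define u where "u = x'' - z"
  define d where "d = x'' - x"
  have xz: "x - z = u - d" and v1: "v1 = \<theta> *\<^sub>R u + n *\<^sub>R d"
    by (simp_all add: u_def d_def v1_def)
  have lamN: "\<theta> \<le> N"
    using lam n by (simp add: N_def \<mu>_def)
  have "1 / n * inner (v1 + \<theta> *\<^sub>R u) (v1 - \<theta> *\<^sub>R u) = inner v1 d + \<theta> * inner u d"
    using n by (simp add: v1 inner_add_left field_simps)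
  also have "inner (v1 + \<theta> *\<^sub>R u) (v1 - \<theta> *\<^sub>R u) = (norm v1)\<^sup>2 - \<theta>\<^sup>2 * (norm u)\<^sup>2"
    unfolding power2_norm_eq_inner
    by (simp add: inner_diff_right inner_add_left inner_commute[of u v1] power2_eq_square algebra_simps)
  finally have e1: "inner v1 d + \<theta> * inner u d = 1 / n * ((norm v1)\<^sup>2 - \<theta>\<^sup>2 * (norm u)\<^sup>2)" ..
  have "(norm v1)\<^sup>2 / 2 + \<mu> * inner v1 d + \<mu>\<^sup>2 / 2 * (norm d)\<^sup>2 - \<theta> * \<mu> / 2 * (norm (u - d))\<^sup>2
      = B1 + \<mu> * (inner v1 d + \<theta> * inner u d) + \<mu> * (\<mu> - \<theta>) / 2 * (norm d)\<^sup>2"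
    unfolding B1_def u_def[symmetric] power2_norm_eq_inner
    by (simp add: inner_diff_left inner_diff_right inner_commute power2_eq_square) (simp add: field_simps)
  also have "\<mu> * (inner v1 d + \<theta> * inner u d)
      = 2 * \<theta> / n * B1 + (\<mu> - \<theta>) / n * (norm v1)\<^sup>2"
    using n unfolding e1 B1_def u_def[symmetric] by (simp add: field_simps power2_eq_square)
  also have "B1 + (2 * \<theta> / n * B1 + (\<mu> - \<theta>) / n * (norm v1)\<^sup>2) + \<mu> * (\<mu> - \<theta>) / 2 * (norm d)\<^sup>2
      \<ge> (1 + 2 * \<theta> / n) * B1"
  proof -
    have "0 \<le> (\<mu> - \<theta>) / n * (norm v1)\<^sup>2" and "0 \<le> \<mu> * (\<mu> - \<theta>) / 2 * (norm d)\<^sup>2"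
      using lam n by simp_all
    then show ?thesis by (simp add: distrib_right)
  qed
  finally have e2: "(1 + 2 * \<theta> / n) * B1 \<le> (norm v1)\<^sup>2 / 2 + \<mu> * inner v1 d
      + \<mu>\<^sup>2 / 2 * (norm d)\<^sup>2 - \<theta> * \<mu> / 2 * (norm (u - d))\<^sup>2" .
  have "W1 \<le> Wy"
    using desc s by (smt (verit) divide_nonneg_nonneg mult_nonneg_nonneg zero_le_power2)
  then have "s * N * \<theta> * (b - 1) * W1 \<le> s * N * \<theta> * (b - 1) * Wy"
    using s N lam b by (intro mult_left_mono) auto
  moreover have "s * N\<^sup>2 * W1 + (norm v1)\<^sup>2 / 2 \<le> s * N * (N - \<theta>) * W0 + (norm v0)\<^sup>2 / 2
    - s * N * \<theta> * (b - 1) * Wy - \<mu> * inner v1 d - \<mu>\<^sup>2 / 2 * (norm d)\<^sup>2"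
    using inertial_step_energy[OF N[unfolded N_def] lam(1) lamN[unfolded N_def] s y[unfolded N_def]
        x'' H conv desc]
    by (simp add: N_def \<mu>_def v0_def v1_def d_def)
  ultimately show ?thesis
    using e2 unfolding B0_def xz by (simp add: algebra_simps power2_eq_square)
qed

section \<open>Decay of a weighted energy\<close>

lemma powr_increment_bounds:
  fixes m q :: real
  assumes q: "q > 0" and m: "m > q" 
  shows "(m + 1) powr q \<le> (1 + q / (m - q)) * m powr q"
    and "(1 + q / (m + 1)) * m powr q \<le> (m + 1) powr q"
proof -
  have m0: "m > 0" using q m by linarith
  have eq: "(m + 1) powr q = exp (q * ln (1 + 1 / m)) * m powr q"
  proof -
    have "m + 1 = (1 + 1 / m) * m" using m0 by (simp add: field_simps)
    then have "(m + 1) powr q = (1 + 1 / m) powr q * m powr q"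
      using m0 by (simp add: powr_mult)
    moreover have "1 + 1 / m > 0" using m0 by (intro add_pos_pos) auto
    ultimately show ?thesis by (simp add: powr_def)
  qed
  have "ln (1 + 1 / m) \<le> 1 / m"
    using m0 by (intro ln_add_one_self_le_self) auto
  then have "q * ln (1 + 1 / m) \<le> q / m"
    using q mult_left_mono[of "ln (1 + 1 / m)" "1 / m" q] by simp
  then have "exp (q * ln (1 + 1 / m)) \<le> exp (q / m)" by simp
  also have "\<dots> = 1 / exp (- (q / m))" by (simp add: exp_minus field_simps)
  also have "\<dots> \<le> 1 / (1 - q / m)"
    using m m0 exp_ge_add_one_self[of "- (q / m)"] by (intro divide_left_mono mult_pos_pos) auto
  also have "\<dots> = 1 + q / (m - q)"
    using m m0 by (simp add: field_simps)
  finally show "(m + 1) powr q \<le> (1 + q / (m - q)) * m powr q"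
    unfolding eq by (intro mult_right_mono) auto
  have "ln (m / (m + 1)) \<le> m / (m + 1) - 1"
    using m0 by (intro ln_le_minus_one) auto
  moreover have "ln (m / (m + 1)) = - ln (1 + 1 / m)"
    using m0 by (simp add: ln_div field_simps add_pos_pos)
  moreover have "m / (m + 1) - 1 = - 1 / (m + 1)"
    using m0 by (simp add: field_simps)
  ultimately have "1 / (m + 1) \<le> ln (1 + 1 / m)" by simp
  then have "q / (m + 1) \<le> q * ln (1 + 1 / m)"
    using q mult_left_mono[of "1 / (m + 1)" "ln (1 + 1 / m)" q] by simp
  then have "1 + q / (m + 1) \<le> exp (q * ln (1 + 1 / m))"
    using exp_ge_add_one_self[of "q * ln (1 + 1 / m)"] by linarith
  then show "(1 + q / (m + 1)) * m powr q \<le> (m + 1) powr q"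
    unfolding eq by (intro mult_right_mono) auto
qed

text \<open>Sums of powers are handled through a potential \<open>T\<close> whose increments dominate the summands. Both this
and the next lemma serve to bound \<open>\<Sum>k<n. k powr \<delta> * \<epsilon> k\<close> by a multiple of \<open>n powr \<delta>\<close>: for \<open>\<epsilon> k\<close> of order \<open>1 / k ^ 2\<close>
this holds even for \<open>\<delta> = 0\<close>, for \<open>\<epsilon> k\<close> of order \<open>1 / k\<close> it needs \<open>\<delta> > 0\<close>.\<close>

lemma summation_potential_decaying:
  fixes c \<delta> :: real
  assumes "\<delta> \<ge> 0" and "c \<ge> 0"
  shows "\<exists>T C. C > 0 \<and> (\<forall>n::nat. n \<ge> 1 \<longrightarrow> 0 \<le> T n \<and> T n \<le> C * (real n + c) powr \<delta> \<and>
      (real n + c + 1) powr \<delta> / (real n)\<^sup>2 \<le> T (Suc n) - T n)"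
proof (intro exI conjI allI impI)
  define T where "T n = 2 * (real n + c) powr \<delta> * (2 - 1 / real n)" for n :: nat
  show "(4::real) > 0" by simp
  fix n :: nat assume n: "n \<ge> 1"
  have "1 / real n \<le> 1" using n by simp
  then show "0 \<le> T n" by (simp add: T_def)
  show "T n \<le> 4 * (real n + c) powr \<delta>"
    using n mult_left_mono[of "2 - 1 / real n" 2 "(real n + c) powr \<delta>"] by (simp add: T_def)
  have "(real n + c) powr \<delta> \<le> (real n + c + 1) powr \<delta>"
    using assms by (intro powr_mono2) auto
  then have "T n \<le> 2 * (real n + c + 1) powr \<delta> * (2 - 1 / real n)"
    using n unfolding T_def by (intro mult_right_mono mult_left_mono) (auto simp: field_simps)
  moreover have "T (Suc n) = 2 * (real n + c + 1) powr \<delta> * (2 - 1 / (real n + 1))"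
    by (simp add: T_def algebra_simps)
  ultimately have "(real n + c + 1) powr \<delta> * (2 * (1 / real n - 1 / (real n + 1))) \<le> T (Suc n) - T n"
    by (simp add: algebra_simps)
  moreover have "1 / (real n)\<^sup>2 \<le> 2 * (1 / real n - 1 / (real n + 1))"
  proof -
    \<comment> \<open>the factor 2 in T makes up for the shift from n to n + 1\<close>
    have "2 * (1 / real n - 1 / (real n + 1)) = 1 / (real n * ((real n + 1) / 2))"
      using n by (simp add: field_simps)
    moreover have "1 / (real n * real n) \<le> 1 / (real n * ((real n + 1) / 2))"
      using n by (intro divide_left_mono mult_left_mono mult_pos_pos) auto
    ultimately show ?thesis by (simp add: power2_eq_square)
  qed
  then have "(real n + c + 1) powr \<delta> * (1 / (real n)\<^sup>2)
      \<le> (real n + c + 1) powr \<delta> * (2 * (1 / real n - 1 / (real n + 1)))"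
    by (intro mult_left_mono) auto
  ultimately show "(real n + c + 1) powr \<delta> / (real n)\<^sup>2 \<le> T (Suc n) - T n" by simp
qed

lemma summation_potential_growing:
  fixes c \<delta> :: real
  assumes "\<delta> > 0" and "c > \<delta>"
  shows "\<exists>T C. C > 0 \<and> (\<forall>n::nat. n \<ge> 1 \<longrightarrow> 0 \<le> T n \<and> T n \<le> C * (real n + c) powr \<delta> \<and>
      (real n + c + 1) powr \<delta> / real n \<le> T (Suc n) - T n)"
proof (intro exI conjI allI impI)
  define C where "C = (2 + c + \<delta>) / \<delta>"
  define T where "T n = C * (real n + c) powr \<delta>" for n :: nat
  show C0: "C > 0" using assms by (simp add: C_def)
  fix n :: nat assume n: "n \<ge> 1"
  show "0 \<le> T n" using C0 by (simp add: T_def)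
  show "T n \<le> C * (real n + c) powr \<delta>" by (simp add: T_def)
  define m where "m = real n + c"
  have m: "m > \<delta>" "m > 0" "m \<ge> 1" using assms n by (auto simp: m_def)
  have "(1 + \<delta> / (m + 1)) * m powr \<delta> \<le> (m + 1) powr \<delta>"
    by (rule powr_increment_bounds(2)) (use assms m in auto)
  then have "m powr \<delta> \<le> (m + 1) powr \<delta> / (1 + \<delta> / (m + 1))"
    using assms m by (simp add: pos_le_divide_eq add_pos_pos mult.commute)
  also have "\<dots> = (m + 1) powr \<delta> - (m + 1) powr \<delta> * (\<delta> / (m + 1 + \<delta>))"
    using assms m by (simp add: field_simps add_pos_pos)
  finally have *: "(m + 1) powr \<delta> * (\<delta> / (m + 1 + \<delta>)) \<le> (m + 1) powr \<delta> - m powr \<delta>" by simp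
  have "(c + 1 + \<delta>) * 1 \<le> (c + 1 + \<delta>) * real n"
    using n assms by (intro mult_left_mono) auto
  then have "m + 1 + \<delta> \<le> (2 + c + \<delta>) * real n"
    by (simp add: m_def algebra_simps)
  then have "1 / real n \<le> (2 + c + \<delta>) / (m + 1 + \<delta>)"
    using n assms m by (simp add: pos_divide_le_eq pos_le_divide_eq)
  also have "\<dots> = C * (\<delta> / (m + 1 + \<delta>))"
    using assms by (simp add: C_def)
  finally have "1 / real n \<le> C * (\<delta> / (m + 1 + \<delta>))" .
  then have "(m + 1) powr \<delta> * (1 / real n) \<le> (m + 1) powr \<delta> * (C * (\<delta> / (m + 1 + \<delta>)))"
    by (intro mult_left_mono) auto
  also have "\<dots> \<le> C * ((m + 1) powr \<delta> - m powr \<delta>)"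
    using mult_left_mono[OF *, of C] C0 by (simp add: mult_ac)
  also have "\<dots> = T (Suc n) - T n" by (simp add: T_def m_def algebra_simps)
  finally show "(real n + c + 1) powr \<delta> / real n \<le> T (Suc n) - T n" by (simp add: m_def)
qed

text \<open>The two sides agree in their two leading powers of \<open>N\<close>; the shift \<open>j\<close> of the weights is chosen so large
that the linear term decides in favour of the right-hand side.\<close>

lemma weight_polynomial_ineq:
  fixes N j q \<theta> :: real
  assumes q: "q > 0" and th: "\<theta> \<ge> 0" and j: "j = 2 + 2 / q" and N: "N \<ge> j + q"
  shows "(N + j + q) * ((N + 1) * (N + 1 - \<theta>)) \<le> (N + j) * (N * (N + 2 + q - \<theta>))"
proof -
  have jq: "j * q = 2 * q + 2" using q by (simp add: j field_simps)
  have "(N + j) * (N * (N + 2 + q - \<theta>)) - (N + j + q) * ((N + 1) * (N + 1 - \<theta>))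
      = N * (j * q - (1 - \<theta>) - q * (2 - \<theta>)) - (j + q) * (1 - \<theta>)"
    by (simp add: algebra_simps)
  also have "j * q - (1 - \<theta>) - q * (2 - \<theta>) = 1 + \<theta> + q * \<theta>"
    by (simp add: jq algebra_simps)
  finally have "(N + j) * (N * (N + 2 + q - \<theta>)) - (N + j + q) * ((N + 1) * (N + 1 - \<theta>))
      = N * (1 + \<theta> + q * \<theta>) - (j + q) * (1 - \<theta>)" .
  moreover have "(j + q) * (1 - \<theta>) \<le> (j + q) * 1"
    using q th by (intro mult_left_mono) (auto simp: j)
  moreover have "N * 1 \<le> N * (1 + \<theta> + q * \<theta>)"
  proof (intro mult_left_mono)
    show "0 \<le> N" using q N by (smt (verit) divide_nonneg_nonneg j)
  qed (use q th in auto)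
  ultimately show ?thesis using N by simp
qed


text \<open>The rate is obtained by a bootstrap. Multiplied by a weight of order \<open>n powr q\<close>, the energy
\<open>s N (N - \<theta>) W + B\<close> decreases up to an error caused by the negative part of \<open>B\<close>, which is at most a multiple of
\<open>U\<close>, the squared distance to the minimizers. The growth condition bounds \<open>U\<close> by \<open>W powr (2 / p)\<close>. In terms
of \<open>w n = n powr r * W n\<close> all powers of \<open>n\<close> match and the estimate reads \<open>w \<le> K * M powr (2 / p)\<close>, where \<open>M\<close> is the
maximum of \<open>w\<close> so far; as \<open>2 / p < 1\<close>, this bounds \<open>w\<close>.

Two choices of \<open>q\<close> matter. If \<open>q = 2 * \<theta>\<close>, the weight cancels the factor \<open>1 + 2 * \<theta> / n\<close> to first order and
the error is summable, so \<open>q = r - 2\<close> is admissible. If \<open>q\<close> is smaller than \<open>2 * \<theta>\<close>, an error of relative order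
\<open>1 / n\<close> remains, and it is absorbed by the growth of the weights when \<open>q > r - 2\<close>.\<close>

lemma decay_of_weighted_energy:
  fixes W B U :: "nat \<Rightarrow> real" and p r q \<theta> \<alpha> b s \<kappa> Cu :: real
  assumes p: "p > 2" and r: "r = 2 * p / (p - 2)" and s: "s > 0" and \<kappa>: "\<kappa> \<ge> 0" and Cu: "Cu \<ge> 0"
    and th: "\<theta> \<ge> 0" and q: "q > 0" "q = \<theta> * b - 2" "q \<le> 2 * \<theta>" and \<alpha>: "\<alpha> \<ge> 1"
    and reg: "q = 2 * \<theta> \<and> r - 2 \<le> q \<or> r - 2 < q"
    and W0: "eventually (\<lambda>n. 0 \<le> W n) sequentially"
    and U: "eventually (\<lambda>n. U n \<le> Cu * W n powr (2 / p)) sequentially"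
    and B: "eventually (\<lambda>n. - (\<kappa> * U n) \<le> B n) sequentially"
    and step: "eventually (\<lambda>n.
        s * (real n + \<alpha> - 1) * (real n + \<alpha> - 1 + \<theta> * (b - 1)) * W (Suc n) + (1 + 2 * \<theta> / real n) * B (Suc n)
      \<le> s * (real n + \<alpha> - 1) * (real n + \<alpha> - 1 - \<theta>) * W n + B n) sequentially"
  shows "W \<in> O[sequentially](\<lambda>n. real n powr (- r))"
proof -
  define \<delta> where "\<delta> = q + 2 - r"
  define j where "j = 2 + 2 / q"
  \<comment> \<open>the weights are powers of n + c; the part j + q of the shift serves the polynomial inequality above\<close>
  define c where "c = \<alpha> - 1 + j + q"
  define m where "m n = real n + c" for n :: nat
  define N where "N n = real n + \<alpha> - 1" for n :: nat
  define w where "w n = m n powr r * W n" for n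
  define H where "H n = m n powr q * (s * N n * (N n - \<theta>) * W n + B n)" for n
  \<comment> \<open>first-order discrepancy between the weights and the factor in front of B\<close>
  define e where "e n = 2 * \<theta> / real n - q / (m n + 1)" for n
  have j2: "j \<ge> 2" using q by (simp add: j_def)
  have c: "c \<ge> 2" "c > q" using j2 q \<alpha> by (auto simp: c_def)
  have m1: "m n \<ge> 1" "m n > 0" "m n \<ge> real n" and mS: "m (Suc n) = m n + 1" for n
    using c by (auto simp: m_def)
  have NN: "m n = N n + j + q" "N (Suc n) = N n + 1" "N n \<ge> real n" for n
    using \<alpha> by (auto simp: m_def N_def c_def)
  have r2: "r - 2 = 4 / (p - 2)" "r * (2 / p) = r - 2" "r > 2"
    using p by (auto simp: r field_simps)
  have \<delta>0: "\<delta> \<ge> 0" using reg by (auto simp: \<delta>_def)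
  have "\<delta> < c" using c r2 by (auto simp: \<delta>_def)
  \<comment> \<open>a potential whose increments dominate the errors made by the weights\<close>
  obtain T Ct Ce where T: "\<And>n. n \<ge> 1 \<Longrightarrow> 0 \<le> T n" "\<And>n. n \<ge> 1 \<Longrightarrow> T n \<le> Ct * m n powr \<delta>"
      "\<And>n. n \<ge> 1 \<Longrightarrow> e n * m (Suc n) powr \<delta> \<le> Ce * (T (Suc n) - T n)"
      "\<And>n. n \<ge> 1 \<Longrightarrow> T n \<le> T (Suc n)" and Ce: "Ce \<ge> 0" and Ct: "Ct \<ge> 0"
  proof (cases "q = 2 * \<theta>")
    case True
    obtain T C where C: "C > 0" and TC: "\<And>n::nat. n \<ge> 1 \<Longrightarrow> 0 \<le> T n \<and> T n \<le> C * (real n + c) powr \<delta> \<and>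
      (real n + c + 1) powr \<delta> / (real n)\<^sup>2 \<le> T (Suc n) - T n"
      using summation_potential_decaying[of \<delta> c] \<delta>0 c by auto
    have "e n * m (Suc n) powr \<delta> \<le> q * (c + 1) * (T (Suc n) - T n)" if n: "n \<ge> 1" for n
    proof -
      have "e n = q * (c + 1) / (real n * (m n + 1))"
        using n m1[of n] by (simp add: e_def True m_def field_simps)
      also have "\<dots> \<le> q * (c + 1) / (real n * real n)"
        using n q c m1[of n] by (intro divide_left_mono mult_left_mono mult_pos_pos) auto
      finally have "e n * m (Suc n) powr \<delta> \<le> q * (c + 1) / (real n * real n) * m (Suc n) powr \<delta>"
        by (intro mult_right_mono) auto
      also have "\<dots> = q * (c + 1) * ((real n + c + 1) powr \<delta> / (real n)\<^sup>2)"
        by (simp add: mS m_def power2_eq_square add_ac)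
      also have "\<dots> \<le> q * (c + 1) * (T (Suc n) - T n)"
        using q c TC[OF n] by (intro mult_left_mono) auto
      finally show ?thesis .
    qed
    moreover have "T n \<le> T (Suc n)" if n: "n \<ge> 1" for n
      using TC[OF n] by (smt (verit) divide_nonneg_nonneg powr_ge_zero zero_le_power2)
    ultimately show ?thesis
      using that[of T C "q * (c + 1)"] TC C q c by (auto simp: m_def)
  next
    case False
    then have "\<delta> > 0" using reg by (auto simp: \<delta>_def)
    then obtain T C where C: "C > 0" and TC: "\<And>n::nat. n \<ge> 1 \<Longrightarrow> 0 \<le> T n \<and> T n \<le> C * (real n + c) powr \<delta> \<and>
      (real n + c + 1) powr \<delta> / real n \<le> T (Suc n) - T n"
      using summation_potential_growing[of \<delta> c] \<open>\<delta> < c\<close> by auto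
    have "e n * m (Suc n) powr \<delta> \<le> 2 * \<theta> * (T (Suc n) - T n)" if n: "n \<ge> 1" for n
    proof -
      have "e n \<le> 2 * \<theta> / real n" using q m1[of n] by (simp add: e_def)
      then have "e n * m (Suc n) powr \<delta> \<le> 2 * \<theta> / real n * m (Suc n) powr \<delta>"
        by (intro mult_right_mono) auto
      also have "\<dots> = 2 * \<theta> * ((real n + c + 1) powr \<delta> / real n)"
        by (simp add: mS m_def add_ac)
      also have "\<dots> \<le> 2 * \<theta> * (T (Suc n) - T n)"
        using th TC[OF n] by (intro mult_left_mono) auto
      finally show ?thesis .
    qed
    moreover have "T n \<le> T (Suc n)" if n: "n \<ge> 1" for n
      using TC[OF n] by (smt (verit) divide_nonneg_nonneg powr_ge_zero of_nat_0_le_iff)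
    ultimately show ?thesis
      using that[of T C "2 * \<theta>"] TC C th by (auto simp: m_def)
  qed
  define D where "D = Ce * \<kappa> * Cu"
  have D: "D \<ge> 0" using Ce \<kappa> Cu by (simp add: D_def)
  have "eventually (\<lambda>n. real n \<ge> j + q + 2 * \<theta> + 1) sequentially" by real_asymp
  from eventually_conj[OF this eventually_conj[OF W0 eventually_conj[OF U eventually_conj[OF B step]]]]
  obtain n1 where n1: "\<And>n. n \<ge> n1 \<Longrightarrow> real n \<ge> j + q + 2 * \<theta> + 1 \<and> 0 \<le> W n \<and>
      U n \<le> Cu * W n powr (2 / p) \<and> - (\<kappa> * U n) \<le> B n \<and>
      s * N n * (N n + \<theta> * (b - 1)) * W (Suc n) + (1 + 2 * \<theta> / real n) * B (Suc n)
        \<le> s * N n * (N n - \<theta>) * W n + B n"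
    unfolding eventually_sequentially N_def by blast
  have "real n1 \<ge> 1" using n1[of n1] j2 q th by auto
  then have n1_1: "n1 \<ge> 1" by simp
  have w0: "w n \<ge> 0" if "n \<ge> n1" for n
    using n1[OF that] by (simp add: w_def)
  have U_w: "m n powr q * U n \<le> Cu * (m n powr \<delta> * w n powr (2 / p))" if "n \<ge> n1" for n
  proof -
    have "W n = m n powr (- r) * w n"
      using m1[of n] by (simp add: w_def powr_minus)
    then have "W n powr (2 / p) = (m n powr (- r)) powr (2 / p) * w n powr (2 / p)"
      using w0[OF that] by (simp add: powr_mult)
    also have "(m n powr (- r)) powr (2 / p) = m n powr (- (r - 2))"
      using r2 by (simp add: powr_powr)
    finally have "m n powr q * W n powr (2 / p) = m n powr \<delta> * w n powr (2 / p)"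
      by (simp add: \<delta>_def flip: powr_add) (simp add: algebra_simps flip: powr_add mult.assoc)
    moreover have "m n powr q * U n \<le> m n powr q * (Cu * W n powr (2 / p))"
      using n1[OF that] by (intro mult_left_mono) auto
    ultimately show ?thesis by (simp add: mult_ac)
  qed
  have H_step: "H (Suc n) \<le> H n + D * (T (Suc n) - T n) * w (Suc n) powr (2 / p)" if n: "n \<ge> n1" for n
  proof -
    note f = n1[OF n] and f' = n1[OF le_SucI[OF n]]
    have n0: "real n > 0" using f j2 q th by auto
    have n_1: "n \<ge> 1" using n n1_1 by simp
    define \<rho> where "\<rho> = m (Suc n) powr q / m n powr q"
    have mpos: "m n powr q > 0" using m1[of n] by simp
    have "m n > q" using NN[of n] n0 j2 by linarith
    moreover have "m n - q = N n + j" using NN(1)[of n] by simp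
    ultimately have pw: "(m n + 1) powr q \<le> (1 + q / (N n + j)) * m n powr q"
        "(1 + q / (m n + 1)) * m n powr q \<le> (m n + 1) powr q"
      using powr_increment_bounds[OF q(1), of "m n"] by auto
    have \<rho>u: "\<rho> \<le> 1 + q / (N n + j)" and \<rho>l: "1 + q / (m n + 1) \<le> \<rho>"
      using pw mpos by (simp_all add: \<rho>_def mS pos_divide_le_eq pos_le_divide_eq)
    have "q / (N n + j) \<le> 2 * \<theta> / real n"
      using q j2 n0 NN(3)[of n] by (intro frac_le) auto
    then have \<rho>2: "\<rho> \<le> 1 + 2 * \<theta> / real n" using \<rho>u by linarith
    have e: "1 + 2 * \<theta> / real n - \<rho> \<le> e n" using \<rho>l by (simp add: e_def)
    have Nj: "N n + j > 0" "N n \<ge> j + q" "N n + 1 - \<theta> \<ge> 0" "N n > 0"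
      using NN(3)[of n] f j2 q th by linarith+
    have "(1 + q / (N n + j)) * ((N n + 1) * (N n + 1 - \<theta>)) \<le> N n * (N n + 2 + q - \<theta>)"
      using weight_polynomial_ineq[OF q(1) th j_def Nj(2)] Nj(1) by (simp add: field_simps)
    also have "N n + 2 + q - \<theta> = N n + \<theta> * (b - 1)" using q by (simp add: algebra_simps)
    finally have poly: "(1 + q / (N n + j)) * ((N n + 1) * (N n + 1 - \<theta>)) \<le> N n * (N n + \<theta> * (b - 1))" .
    have "\<rho> * ((N n + 1) * (N n + 1 - \<theta>)) \<le> (1 + q / (N n + j)) * ((N n + 1) * (N n + 1 - \<theta>))"
      using \<rho>u Nj by (intro mult_right_mono) auto
    also note poly
    finally have "\<rho> * ((N n + 1) * (N n + 1 - \<theta>)) * (s * W (Suc n)) \<le> N n * (N n + \<theta> * (b - 1)) * (s * W (Suc n))"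
      using s f' by (intro mult_right_mono) auto
    then have Wpart: "\<rho> * (s * N (Suc n) * (N (Suc n) - \<theta>) * W (Suc n)) \<le> s * N n * (N n + \<theta> * (b - 1)) * W (Suc n)"
      by (simp add: NN(2) mult_ac)
    have "(1 + 2 * \<theta> / real n - \<rho>) * (- (\<kappa> * U (Suc n))) \<le> (1 + 2 * \<theta> / real n - \<rho>) * B (Suc n)"
      using \<rho>2 f' by (intro mult_left_mono) auto
    then have Bpart: "\<rho> * B (Suc n) \<le> (1 + 2 * \<theta> / real n) * B (Suc n) + (1 + 2 * \<theta> / real n - \<rho>) * (\<kappa> * U (Suc n))"
      by (simp add: algebra_simps)
    have U': "m n powr q * U (Suc n) \<le> Cu * (m (Suc n) powr \<delta> * w (Suc n) powr (2 / p))"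
    proof (cases "U (Suc n) \<ge> 0")
      case True
      have "m n powr q \<le> m (Suc n) powr q"
        using q m1[of n] by (intro powr_mono2) (auto simp: mS)
      then have "m n powr q * U (Suc n) \<le> m (Suc n) powr q * U (Suc n)"
        using True by (intro mult_right_mono) auto
      with U_w[of "Suc n"] n show ?thesis by simp
    next
      case False
      then have "m n powr q * U (Suc n) \<le> 0" by (simp add: mult_nonneg_nonpos)
      also have "0 \<le> Cu * (m (Suc n) powr \<delta> * w (Suc n) powr (2 / p))" using Cu by simp
      finally show ?thesis .
    qed
    have "H (Suc n) = m n powr q * (\<rho> * (s * N (Suc n) * (N (Suc n) - \<theta>) * W (Suc n)) + \<rho> * B (Suc n))"
      using mpos by (simp add: H_def \<rho>_def field_simps)
    also have "\<dots> \<le> m n powr q * ((s * N n * (N n - \<theta>) * W n + B n) + (1 + 2 * \<theta> / real n - \<rho>) * (\<kappa> * U (Suc n)))"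
      using Wpart Bpart f by (intro mult_left_mono) auto
    also have "\<dots> = H n + (1 + 2 * \<theta> / real n - \<rho>) * \<kappa> * (m n powr q * U (Suc n))"
      by (simp add: H_def algebra_simps)
    also have "\<dots> \<le> H n + (1 + 2 * \<theta> / real n - \<rho>) * \<kappa> * (Cu * (m (Suc n) powr \<delta> * w (Suc n) powr (2 / p)))"
      using U' \<rho>2 \<kappa> by (intro add_left_mono mult_left_mono) auto
    also have "\<dots> \<le> H n + e n * \<kappa> * (Cu * (m (Suc n) powr \<delta> * w (Suc n) powr (2 / p)))"
      using e \<kappa> Cu by (intro add_left_mono mult_right_mono) auto
    also have "\<dots> = H n + (e n * m (Suc n) powr \<delta>) * (\<kappa> * Cu * w (Suc n) powr (2 / p))"
      by (simp add: mult_ac)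
    also have "\<dots> \<le> H n + (Ce * (T (Suc n) - T n)) * (\<kappa> * Cu * w (Suc n) powr (2 / p))"
      using T(3)[OF n_1] \<kappa> Cu by (intro add_left_mono mult_right_mono) auto
    finally show ?thesis by (simp add: D_def mult_ac)
  qed
  have H_upper: "H n \<le> H n1 + D * (T n - T n1) * M powr (2 / p)"
    if "n \<ge> n1" "\<And>k. n1 \<le> k \<Longrightarrow> k \<le> n \<Longrightarrow> w k \<le> M" for n M
    using that
  proof (induction n rule: nat_induct_at_least)
    case (Suc n)
    have "w (Suc n) powr (2 / p) \<le> M powr (2 / p)"
      using Suc w0 p by (intro powr_mono2) auto
    then have "D * (T (Suc n) - T n) * w (Suc n) powr (2 / p) \<le> D * (T (Suc n) - T n) * M powr (2 / p)"
      using D T(4)[of n] Suc.hyps n1_1 by (intro mult_left_mono) auto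
    with H_step[OF Suc.hyps] Suc.IH Suc.prems show ?case
      by (simp add: algebra_simps)
  qed simp
  define K where "K = 4 / s * (\<bar>H n1\<bar> + D * Ct + \<kappa> * Cu) + 1"
  have K1: "K \<ge> 1" using s D Ct \<kappa> Cu by (simp add: K_def)
  have w_le: "w n \<le> K * M powr (2 / p)"
    if n: "n \<ge> n1" and M: "M \<ge> 1" "\<And>k. n1 \<le> k \<Longrightarrow> k \<le> n \<Longrightarrow> w k \<le> M" for n M
  proof -
    note f = n1[OF n]
    have n_1: "n \<ge> 1" using n n1_1 by simp
    have Nm: "N n \<ge> m n / 2" "N n - \<theta> \<ge> m n / 2"
      using NN(1,3)[of n] f th by linarith+
    have "m n * m n / 4 \<le> N n * (N n - \<theta>)"
      using mult_mono[OF Nm] m1[of n] Nm by simp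
    then have "s * (m n * m n / 4) * W n \<le> s * (N n * (N n - \<theta>)) * W n"
      using s f by (intro mult_right_mono mult_left_mono) auto
    then have "s / 4 * (m n)\<^sup>2 * W n \<le> s * N n * (N n - \<theta>) * W n"
      by (simp add: power2_eq_square mult_ac)
    then have "m n powr q * (s / 4 * (m n)\<^sup>2 * W n - \<kappa> * U n) \<le> H n"
      unfolding H_def using f by (intro mult_left_mono) auto
    moreover have "m n powr q * (s / 4 * (m n)\<^sup>2 * W n - \<kappa> * U n)
        = s / 4 * (m n powr q * (m n)\<^sup>2 * W n) - \<kappa> * (m n powr q * U n)"
      by (simp add: algebra_simps)
    moreover have "m n powr q * (m n)\<^sup>2 * W n = m n powr \<delta> * w n"
      using m1[of n] by (simp add: w_def \<delta>_def powr_add powr_diff powr_numeral)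
    then have "s / 4 * (m n powr q * (m n)\<^sup>2 * W n) = s / 4 * (m n powr \<delta> * w n)" by simp
    moreover have "\<kappa> * (m n powr q * U n) \<le> \<kappa> * (Cu * (m n powr \<delta> * w n powr (2 / p)))"
      using U_w[OF n] \<kappa> by (intro mult_left_mono) auto
    ultimately have a: "s / 4 * (m n powr \<delta> * w n) \<le> H n + \<kappa> * (Cu * (m n powr \<delta> * w n powr (2 / p)))"
      by linarith
    have "w n powr (2 / p) \<le> M powr (2 / p)"
      using M(2)[of n] w0[OF n] n p by (intro powr_mono2) auto
    then have b: "\<kappa> * (Cu * (m n powr \<delta> * w n powr (2 / p))) \<le> \<kappa> * Cu * (m n powr \<delta> * M powr (2 / p))"
      using \<kappa> Cu by (simp add: mult_left_mono mult.assoc)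
    have m\<delta>: "m n powr \<delta> \<ge> 1" using m1[of n] \<delta>0 by (intro ge_one_powr_ge_zero) auto
    have Mp: "M powr (2 / p) \<ge> 1" using M p by (intro ge_one_powr_ge_zero) auto
    have "D * (T n - T n1) * M powr (2 / p) \<le> D * (Ct * m n powr \<delta>) * M powr (2 / p)"
      using D T(1)[OF n1_1] T(2)[OF n_1] by (intro mult_right_mono mult_left_mono) auto
    with H_upper[OF n M(2)] have c: "H n \<le> \<bar>H n1\<bar> + D * Ct * (m n powr \<delta> * M powr (2 / p))"
      by (simp add: mult_ac)
    have "\<bar>H n1\<bar> * (1 * 1) \<le> \<bar>H n1\<bar> * (m n powr \<delta> * M powr (2 / p))"
      using m\<delta> Mp by (intro mult_left_mono mult_mono) auto
    with a b c have "s / 4 * (m n powr \<delta> * w n)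
        \<le> (\<bar>H n1\<bar> + D * Ct + \<kappa> * Cu) * (m n powr \<delta> * M powr (2 / p))"
      by (simp add: distrib_right)
    then have "m n powr \<delta> * (s / 4 * w n) \<le> m n powr \<delta> * ((\<bar>H n1\<bar> + D * Ct + \<kappa> * Cu) * M powr (2 / p))"
      by (simp add: mult_ac)
    then have "s / 4 * w n \<le> (\<bar>H n1\<bar> + D * Ct + \<kappa> * Cu) * M powr (2 / p)"
      using m\<delta> by (subst (asm) mult_le_cancel_left_pos) auto
    then have "w n \<le> (K - 1) * M powr (2 / p)"
    proof -
      have "(K - 1) * M powr (2 / p) = 4 * ((\<bar>H n1\<bar> + D * Ct + \<kappa> * Cu) * M powr (2 / p)) / s"
        by (simp add: K_def)
      moreover assume "s / 4 * w n \<le> (\<bar>H n1\<bar> + D * Ct + \<kappa> * Cu) * M powr (2 / p)"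
      then have "w n * s \<le> 4 * ((\<bar>H n1\<bar> + D * Ct + \<kappa> * Cu) * M powr (2 / p))" by (simp add: mult_ac)
      ultimately show ?thesis using s by (simp only: pos_le_divide_eq)
    qed
    then show ?thesis using Mp by (simp add: left_diff_distrib)
  qed
  define M where "M = K powr (p / (p - 2))"
  have M1: "M \<ge> 1" unfolding M_def using K1 p by (intro ge_one_powr_ge_zero) auto
  \<comment> \<open>beyond \<open>M\<close> the sublinear power loses against the identity\<close>
  have beyond: "K * x powr (2 / p) < x" if "x > M" for x
  proof -
    have "x powr (1 - 2 / p) > M powr (1 - 2 / p)"
      using that M1 p by (intro powr_less_mono2) auto
    moreover have "M powr (1 - 2 / p) = K"
      using K1 p by (simp add: M_def powr_powr divide_simps)
    ultimately have "K * x powr (2 / p) < x powr (1 - 2 / p) * x powr (2 / p)"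
      using that M1 by (intro mult_strict_right_mono) auto
    then show ?thesis using that M1 by (simp flip: powr_add)
  qed
  have "w n \<le> M" if "n \<ge> n1" for n
    using that
  proof (induction n rule: less_induct)
    case (less n)
    show ?case
    proof (rule ccontr)
      assume "\<not> w n \<le> M"
      then have gt: "w n > M" by simp
      have "w k \<le> w n" if "n1 \<le> k" "k \<le> n" for k
        using less.IH[of k] that gt by (cases "k = n") auto
      from w_le[OF less.prems _ this] gt M1 have "w n \<le> K * w n powr (2 / p)" by auto
      with beyond[OF gt] show False by simp
    qed
  qed
  then have "norm (W n) \<le> M * norm (real n powr (- r))" if "n \<ge> n1" for n
  proof -
    have "W n = m n powr (- r) * w n"
      using m1[of n] by (simp add: w_def powr_minus)
    also have "\<dots> \<le> real n powr (- r) * M"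
      using \<open>\<And>n. n \<ge> n1 \<Longrightarrow> w n \<le> M\<close>[OF that] w0[OF that] m1[of n] r2 that n1_1
      by (intro mult_mono powr_mono2') auto
    finally show ?thesis using n1[OF that] by (simp add: mult.commute)
  qed
  then show ?thesis
    by (intro bigoI[of _ M]) (auto simp: eventually_sequentially)
qed

section \<open>Minimizers and growth of convex functions\<close>

lemma min_value_eq: "z \<in> minimizers F \<Longrightarrow> min_value F = F z"
  unfolding min_value_def minimizers_def by (intro Least_equality) auto

lemma min_value_le: "minimizers F \<noteq> {} \<Longrightarrow> min_value F \<le> F x"
  using min_value_eq by (fastforce simp: minimizers_def)

lemma closed_convex_minimizers:
  fixes F :: "'a::euclidean_space \<Rightarrow> real"
  assumes "convex_smooth L F"
  shows "closed (minimizers F)" and "convex (minimizers F)"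
proof -
  have cont: "continuous_on UNIV F"
    using assms by (auto simp: convex_smooth_def continuous_on_eq_continuous_at
        intro: differentiable_imp_continuous_within)
  have eq: "minimizers F = (\<Inter>z. {x. F x \<le> F z})"
    by (auto simp: minimizers_def)
  show "closed (minimizers F)"
    unfolding eq by (intro closed_INT ballI closed_Collect_le cont continuous_intros)
  show "convex (minimizers F)"
    unfolding eq
  proof (intro convex_INT)
    fix z
    have "F ((1 - t) *\<^sub>R u + t *\<^sub>R v) \<le> F z"
      if "F u \<le> F z" "F v \<le> F z" "0 \<le> t" "t \<le> 1" for u v t
    proof -
      have "F ((1 - t) *\<^sub>R u + t *\<^sub>R v) \<le> (1 - t) * F u + t * F v"
        using assms that by (intro convex_onD[of UNIV F]) (auto simp: convex_smooth_def)
      also have "\<dots> \<le> F z"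
        using that by (intro convex_bound_le) auto
      finally show ?thesis .
    qed
    then show "convex {x. F x \<le> F z}"
      unfolding convex_alt by auto
  qed
qed

lemma infdist_closest_point:
  fixes S :: "'a::euclidean_space set"
  assumes "closed S" "S \<noteq> {}"
  shows "infdist x S = dist x (closest_point S x)"
  using setdist_closest_point[OF assms, of x] by (simp add: infdist_eq_setdist)

lemma closest_point_singleton: "closest_point {a} x = (a::'a::euclidean_space)"
  using closest_point_in_set[of "{a}" x] by simp

text \<open>The obtuse angle condition at both projections, added up. For the parameter
\<open>\<theta> = (\<alpha> - 1) / 2\<close> it makes the energy decrease when the reference minimizer, the projection of an iterate, is replaced by
the projection of the next one.\<close>

lemma closest_point_monotone:
  fixes S :: "'a::euclidean_space set"
  assumes "closed S" "convex S" "S \<noteq> {}"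
  shows "0 \<le> inner (closest_point S a - closest_point S b) (a - b)"
proof -
  let ?P = "closest_point S"
  have "inner (a - ?P a) (?P b - ?P a) \<le> 0" "inner (b - ?P b) (?P a - ?P b) \<le> 0"
    using assms by (auto intro!: closest_point_dot closest_point_in_set)
  then have "inner (?P a - ?P b) (?P a - ?P b) \<le> inner (?P a - ?P b) (a - b)"
    by (simp add: inner_diff_left inner_diff_right inner_commute)
  then show ?thesis using inner_ge_zero[of "?P a - ?P b"] by linarith
qed

text \<open>The growth condition is assumed near the set of minimizers, the orbit is only known to approach the
minimal value. These match without any compactness: a point at distance more than \<open>\<epsilon>\<close> can be moved along the
segment to its projection until its distance is \<open>\<epsilon>\<close>, and by convexity the value does not increase.\<close>

lemma growth_near_minimal_value:
  fixes F :: "'a::euclidean_space \<Rightarrow> real"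
  assumes F: "convex_smooth L F" and ne: "minimizers F \<noteq> {}" and Lset: "cond_Lset p F"
  obtains K \<omega> where "K > 0" "\<omega> > 0"
    "\<And>x. F x - min_value F < \<omega> \<Longrightarrow> K * infdist x (minimizers F) powr p \<le> F x - min_value F"
proof -
  let ?S = "minimizers F"
  note S = closed_convex_minimizers[OF F]
  obtain K \<epsilon> where K: "K > 0" "\<epsilon> > 0"
    and KL: "\<And>x. infdist x ?S \<le> \<epsilon> \<Longrightarrow> K * infdist x ?S powr p \<le> F x - min_value F"
    using Lset unfolding cond_Lset_def by blast
  show thesis
  proof (rule that[of K "K * \<epsilon> powr p"])
    fix x assume small: "F x - min_value F < K * \<epsilon> powr p"
    have "infdist x ?S \<le> \<epsilon>"
    proof (rule ccontr)
      define D where "D = infdist x ?S"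
      define P where "P = closest_point ?S x"
      define t where "t = \<epsilon> / D"
      define xt where "xt = (1 - t) *\<^sub>R P + t *\<^sub>R x"
      assume "\<not> infdist x ?S \<le> \<epsilon>"
      then have D: "D > \<epsilon>" by (simp add: D_def)
      then have t: "0 < t" "t < 1" using K by (auto simp: t_def)
      have PS: "P \<in> ?S" unfolding P_def using S ne by (intro closest_point_in_set)
      have DP: "D = norm (x - P)"
        using infdist_closest_point[OF S(1) ne] by (simp add: D_def P_def dist_norm)
      have "xt - P = t *\<^sub>R (x - P)" and xxt: "x - xt = (1 - t) *\<^sub>R (x - P)"
        by (simp_all add: xt_def algebra_simps)
      then have "dist xt P = \<epsilon>"
        using t D K by (simp add: dist_norm t_def flip: DP)
      then have le: "infdist xt ?S \<le> \<epsilon>"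
        using infdist_le[OF PS, of xt] by simp
      have "dist x xt = (1 - t) * D"
        using t by (simp add: dist_norm xxt DP)
      also have "\<dots> = D - \<epsilon>"
        using D K by (simp add: t_def field_simps)
      finally have "dist x xt = D - \<epsilon>" .
      then have "\<epsilon> \<le> infdist xt ?S"
        using infdist_triangle[of x ?S xt] by (simp add: D_def)
      with le have "infdist xt ?S = \<epsilon>" by simp
      with KL[of xt] have "K * \<epsilon> powr p \<le> F xt - min_value F" by simp
      also have "F xt \<le> (1 - t) * F P + t * F x"
        unfolding xt_def using F t by (intro convex_onD[of UNIV F]) (auto simp: convex_smooth_def)
      also have "F P = min_value F" using min_value_eq[OF PS] by simp
      also have "(1 - t) * min_value F + t * F x - min_value F = t * (F x - min_value F)"
        by (simp add: algebra_simps)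
      also have "\<dots> \<le> F x - min_value F"
        using t min_value_le[OF ne, of x] by (simp add: mult_left_le_one_le)
      finally show False using small by simp
    qed
    then show "K * infdist x ?S powr p \<le> F x - min_value F" by (rule KL)
  qed (use K in auto)
qed

section \<open>Upper bounds for the orbits\<close>

definition cd_extrapolated ::
    "real \<Rightarrow> real \<Rightarrow> ('a::euclidean_space \<Rightarrow> real) \<Rightarrow> 'a \<Rightarrow> 'a \<Rightarrow> nat \<Rightarrow> 'a" where
  "cd_extrapolated \<alpha> s F x0 x1 n = cd_orbit \<alpha> s F x0 x1 n +
     cd_coeff \<alpha> n *\<^sub>R (cd_orbit \<alpha> s F x0 x1 n - cd_orbit \<alpha> s F x0 x1 (n - 1))"

lemma cd_orbit_Suc:
  "n \<ge> 1 \<Longrightarrow> cd_orbit \<alpha> s F x0 x1 (Suc n) =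
     cd_extrapolated \<alpha> s F x0 x1 n - s *\<^sub>R gradient F (cd_extrapolated \<alpha> s F x0 x1 n)"
  by (cases n) (auto simp: cd_extrapolated_def Let_def)

lemma cd_step_ineqs:
  fixes F :: "'a::euclidean_space \<Rightarrow> real" and \<alpha> s :: real and x0 x1 :: 'a
  assumes F: "convex_smooth L F" and s: "0 < s" "s * L \<le> 1" and n: "n \<ge> 1"
  defines "x \<equiv> cd_orbit \<alpha> s F x0 x1" and "y \<equiv> cd_extrapolated \<alpha> s F x0 x1"
  shows "F (y n) - F z \<le> inner (gradient F (y n)) (y n - z)"
    and "F (x (Suc n)) \<le> F (y n) - s / 2 * (norm (gradient F (y n)))\<^sup>2"
proof -
  show "F (y n) - F z \<le> inner (gradient F (y n)) (y n - z)"
    using convex_gradient_ineq[of F "y n" z] F by (simp add: convex_smooth_def inner_diff_right)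
  show "F (x (Suc n)) \<le> F (y n) - s / 2 * (norm (gradient F (y n)))\<^sup>2"
    using gradient_descent_ineq[OF F, of s "y n"] s cd_orbit_Suc[OF n, of \<alpha> s F x0 x1]
    by (simp add: x_def y_def)
qed

lemma cd_gap_tendsto_0:
  fixes F :: "'a::euclidean_space \<Rightarrow> real"
  assumes F: "convex_smooth L F" and ne: "minimizers F \<noteq> {}" and \<alpha>: "\<alpha> \<ge> 3"
    and s: "0 < s" "s * L \<le> 1"
  shows "cd_gap \<alpha> s F x0 x1 \<longlonglongrightarrow> 0"
proof -
  obtain z where z: "z \<in> minimizers F" using ne by auto
  define x where "x = cd_orbit \<alpha> s F x0 x1"
  define W where "W = cd_gap \<alpha> s F x0 x1"
  define N where "N n = real n + \<alpha> - 1" for n :: nat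
  define E where "E n = s * N n * (N n - 2) * W n
      + (norm (2 *\<^sub>R (x n - z) + (real n - 1) *\<^sub>R (x n - x (n - 1))))\<^sup>2 / 2
      + (\<alpha> - 3) * (norm (x n - z))\<^sup>2" for n
  have W0: "W n \<ge> 0" for n using min_value_le[OF ne] by (simp add: W_def cd_gap_def)
  have E_step: "E (Suc n) \<le> E n" if n: "n \<ge> 1" for n
  proof -
    have N: "N n > 0" "N n \<ge> 2" using n \<alpha> by (auto simp: N_def)
    let ?y = "cd_extrapolated \<alpha> s F x0 x1 n"
    have eq: "2 * (\<alpha> - 1 - 2) / 2 = \<alpha> - 3" by simp
    have "s * (N n)\<^sup>2 * W (Suc n)
        + (norm (2 *\<^sub>R (x (Suc n) - z) + real n *\<^sub>R (x (Suc n) - x n)))\<^sup>2 / 2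
        + 2 * (\<alpha> - 1 - 2) / 2 * (norm (x (Suc n) - z))\<^sup>2
      \<le> s * N n * (N n - 2) * W n
        + (norm (2 *\<^sub>R (x n - z) + (real n - 1) *\<^sub>R (x n - x (n - 1))))\<^sup>2 / 2
        + 2 * (\<alpha> - 1 - 2) / 2 * (norm (x n - z))\<^sup>2"
      unfolding N_def
    proof (rule inertial_step_classical[where y = ?y and g = "gradient F ?y" and Wy = "F ?y - min_value F"])
      show "?y = x n + ((real n - 1) / (real n + \<alpha> - 1)) *\<^sub>R (x n - x (n - 1))"
        by (simp add: cd_extrapolated_def x_def cd_coeff_def)
      show "x (Suc n) = ?y - s *\<^sub>R gradient F ?y"
        unfolding x_def by (rule cd_orbit_Suc[OF n])
      show "F ?y - min_value F \<le> inner (gradient F ?y) (?y - z)"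
        using cd_step_ineqs(1)[OF F s n, of _ _ _ z] by (simp add: min_value_eq[OF z])
      show "F ?y - min_value F - W n \<le> inner (gradient F ?y) (?y - x n)"
        using cd_step_ineqs(1)[OF F s n, of \<alpha> x0 x1 "x n"] by (simp add: W_def cd_gap_def x_def)
      show "W (Suc n) \<le> F ?y - min_value F - s / 2 * (norm (gradient F ?y))\<^sup>2"
        using cd_step_ineqs(2)[OF F s n, of \<alpha> x0 x1] by (simp add: W_def cd_gap_def)
    qed (use N \<alpha> s in \<open>auto simp: N_def\<close>)
    moreover have "N (Suc n) * (N (Suc n) - 2) \<le> (N n)\<^sup>2"
      by (simp add: N_def power2_eq_square algebra_simps)
    then have "s * W (Suc n) * (N (Suc n) * (N (Suc n) - 2)) \<le> s * W (Suc n) * (N n)\<^sup>2"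
      using s W0[of "Suc n"] by (intro mult_left_mono) auto
    ultimately show ?thesis unfolding eq by (simp add: E_def mult_ac)
  qed
  have E_le: "E n \<le> E 1" if "n \<ge> 1" for n
    using that by (induction n rule: nat_induct_at_least) (use E_step in force)+
  have "(\<lambda>n. E 1 / (s * N n * (N n - 2))) \<longlonglongrightarrow> 0"
    unfolding N_def using s by real_asymp
  moreover have "eventually (\<lambda>n. W n \<le> E 1 / (s * N n * (N n - 2))) sequentially"
    using eventually_ge_at_top[of 1]
  proof eventually_elim
    case (elim n)
    have "N n > 2" using elim \<alpha> by (simp add: N_def)
    moreover have "s * N n * (N n - 2) * W n \<le> E n" using \<alpha> by (simp add: E_def)
    ultimately show ?case using E_le[OF elim] s by (simp add: pos_le_divide_eq mult.commute)
  qed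
  ultimately have "W \<longlonglongrightarrow> 0"
    using W0 by (intro tendsto_sandwich[of "\<lambda>_. 0" W sequentially]) auto
  then show ?thesis by (simp add: W_def)
qed

text \<open>Both regimes are instances of this estimate. The reference point of the energy is the projection of
\<open>x n\<close> to the set of minimizers and so may move with \<open>n\<close>. This is harmless if there is one minimizer only. It
is harmless as well if \<open>2 * \<theta> = \<alpha> - 1\<close>: then the squared distances cancel in \<open>B\<close>, and the reference point
enters only through an inner product with the velocity, whose change has the right sign as projections are
monotone.\<close>

lemma cd_gap_bigo_of_scaled_energy:
  fixes F :: "'a::euclidean_space \<Rightarrow> real"
  assumes F: "convex_smooth L F" and ne: "minimizers F \<noteq> {}" and Lset: "cond_Lset p F"
    and \<alpha>: "\<alpha> \<ge> 3" and s: "0 < s" "s * L \<le> 1" and p: "p > 2"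
    and b: "b \<ge> 1" and th: "\<theta> \<ge> 0" "2 * \<theta> \<le> \<alpha> - 1"
    and q: "q > 0" "q = \<theta> * b - 2" "q \<le> 2 * \<theta>"
    and reg: "q = 2 * \<theta> \<and> 2 * p / (p - 2) - 2 \<le> q \<or> 2 * p / (p - 2) - 2 < q"
    and proj: "2 * \<theta> = \<alpha> - 1 \<or> (\<exists>xs. minimizers F = {xs})"
    and H: "eventually (\<lambda>n. let y = cd_extrapolated \<alpha> s F x0 x1 n in b * (F y - min_value F)
       \<le> inner (gradient F y) (y - closest_point (minimizers F) (cd_orbit \<alpha> s F x0 x1 n))) sequentially"
  shows "cd_gap \<alpha> s F x0 x1 \<in> O[sequentially](cd_rate p)"
proof -
  let ?S = "minimizers F"
  note S = closed_convex_minimizers[OF F]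
  define x where "x = cd_orbit \<alpha> s F x0 x1"
  define P where "P n = closest_point ?S (x n)" for n
  define W where "W = cd_gap \<alpha> s F x0 x1"
  define \<mu> where "\<mu> = \<alpha> - 1 - \<theta>"
  define U where "U n = (norm (x n - P n))\<^sup>2" for n
  define B where "B n = (norm (\<theta> *\<^sub>R (x n - P n) + (real n - 1) *\<^sub>R (x n - x (n - 1))))\<^sup>2 / 2
      - \<theta> * \<mu> / 2 * U n" for n
  have \<mu>: "\<mu> \<ge> \<theta>" using th by (simp add: \<mu>_def)
  have W0: "W n \<ge> 0" for n using min_value_le[OF ne] by (simp add: W_def cd_gap_def)
  obtain K \<omega> where K: "K > 0" "\<omega> > 0"
    and growth: "\<And>x. F x - min_value F < \<omega> \<Longrightarrow> K * infdist x ?S powr p \<le> F x - min_value F"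
    using growth_near_minimal_value[OF F ne Lset] by blast
  have "W \<longlonglongrightarrow> 0" unfolding W_def by (rule cd_gap_tendsto_0[OF F ne \<alpha> s])
  then have "eventually (\<lambda>n. W n < \<omega>) sequentially" using K by (simp add: order_tendstoD)
  then have evU: "eventually (\<lambda>n. U n \<le> (1 / K) powr (2 / p) * W n powr (2 / p)) sequentially"
  proof eventually_elim
    case (elim n)
    define D where "D = infdist (x n) ?S"
    have D: "D \<ge> 0" "U n = D\<^sup>2"
      using infdist_closest_point[OF S(1) ne, of "x n"]
      by (auto simp: D_def U_def P_def dist_norm)
    have "K * D powr p \<le> W n"
      using growth[of "x n"] elim by (simp add: W_def cd_gap_def x_def D_def)
    then have "D powr p \<le> 1 / K * W n" using K by (simp add: pos_le_divide_eq mult.commute)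
    then have "(D powr p) powr (2 / p) \<le> (1 / K * W n) powr (2 / p)"
      using p by (intro powr_mono2) auto
    also have "(D powr p) powr (2 / p) = D\<^sup>2"
      using p D by (simp add: powr_powr powr_numeral)
    also have "(1 / K * W n) powr (2 / p) = (1 / K) powr (2 / p) * W n powr (2 / p)"
      by (rule powr_mult)
    finally show ?case by (simp add: D)
  qed
  have step: "eventually (\<lambda>n.
        s * (real n + \<alpha> - 1) * (real n + \<alpha> - 1 + \<theta> * (b - 1)) * W (Suc n) + (1 + 2 * \<theta> / real n) * B (Suc n)
      \<le> s * (real n + \<alpha> - 1) * (real n + \<alpha> - 1 - \<theta>) * W n + B n) sequentially"
    using H eventually_ge_at_top[of 1]
  proof eventually_elim
    case (elim n)
    note n = \<open>1 \<le> n\<close>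
    let ?y = "cd_extrapolated \<alpha> s F x0 x1 n"
    define B1 where "B1 = (norm (\<theta> *\<^sub>R (x (Suc n) - P n) + real n *\<^sub>R (x (Suc n) - x n)))\<^sup>2 / 2
        - \<theta> * (\<alpha> - 1 - \<theta>) / 2 * (norm (x (Suc n) - P n))\<^sup>2"
    have main: "s * (real n + \<alpha> - 1) * (real n + \<alpha> - 1 + \<theta> * (b - 1)) * W (Suc n) + (1 + 2 * \<theta> / real n) * B1
      \<le> s * (real n + \<alpha> - 1) * (real n + \<alpha> - 1 - \<theta>) * W n + B n"
      unfolding B1_def B_def U_def \<mu>_def
    proof (rule inertial_step_scaled[where y = ?y and g = "gradient F ?y" and Wy = "F ?y - min_value F"])
      show "?y = x n + ((real n - 1) / (real n + \<alpha> - 1)) *\<^sub>R (x n - x (n - 1))"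
        by (simp add: cd_extrapolated_def x_def cd_coeff_def)
      show "x (Suc n) = ?y - s *\<^sub>R gradient F ?y"
        unfolding x_def by (rule cd_orbit_Suc[OF n])
      show "b * (F ?y - min_value F) \<le> inner (gradient F ?y) (?y - P n)"
        using elim by (simp add: Let_def P_def x_def)
      show "F ?y - min_value F - W n \<le> inner (gradient F ?y) (?y - x n)"
        using cd_step_ineqs(1)[OF F s n, of \<alpha> x0 x1 "x n"] by (simp add: W_def cd_gap_def x_def)
      show "W (Suc n) \<le> F ?y - min_value F - s / 2 * (norm (gradient F ?y))\<^sup>2"
        using cd_step_ineqs(2)[OF F s n, of \<alpha> x0 x1] by (simp add: W_def cd_gap_def)
    qed (use n \<alpha> s th b in \<open>auto simp: \<mu>_def\<close>)
    have "B (Suc n) \<le> B1"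
      using proj
    proof
      assume "\<exists>xs. minimizers F = {xs}"
      then have "P (Suc n) = P n" by (auto simp: P_def closest_point_singleton)
      then show ?thesis by (simp add: B_def B1_def U_def \<mu>_def)
    next
      assume eq: "2 * \<theta> = \<alpha> - 1"
      then have \<mu>\<theta>: "\<mu> = \<theta>" by (simp add: \<mu>_def)
      define d where "d = x (Suc n) - x n"
      have exp: "(norm (\<theta> *\<^sub>R u + real n *\<^sub>R d))\<^sup>2 / 2 - \<theta> * \<theta> / 2 * (norm u)\<^sup>2
          = \<theta> * real n * inner u d + (real n)\<^sup>2 / 2 * (norm d)\<^sup>2" for u
        unfolding power2_norm_eq_inner
        by (simp add: inner_add_left inner_add_right inner_commute power2_eq_square algebra_simps)
      have "0 \<le> inner (P (Suc n) - P n) d"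
        unfolding P_def d_def using S ne by (intro closest_point_monotone)
      then have "inner (x (Suc n) - P (Suc n)) d \<le> inner (x (Suc n) - P n) d"
        by (simp add: inner_diff_left)
      then have "\<theta> * real n * inner (x (Suc n) - P (Suc n)) d \<le> \<theta> * real n * inner (x (Suc n) - P n) d"
        using th by (intro mult_left_mono) auto
      moreover have "B (Suc n) = \<theta> * real n * inner (x (Suc n) - P (Suc n)) d + (real n)\<^sup>2 / 2 * (norm d)\<^sup>2"
        unfolding exp[symmetric] by (simp add: B_def U_def \<mu>\<theta> d_def)
      moreover have "B1 = \<theta> * real n * inner (x (Suc n) - P n) d + (real n)\<^sup>2 / 2 * (norm d)\<^sup>2"
        unfolding exp[symmetric] using \<mu>\<theta> by (simp add: B1_def \<mu>_def d_def)
      ultimately show ?thesis by simp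
    qed
    then have "(1 + 2 * \<theta> / real n) * B (Suc n) \<le> (1 + 2 * \<theta> / real n) * B1"
      using th by (intro mult_left_mono) auto
    with main show ?case by linarith
  qed
  have "W \<in> O[sequentially](\<lambda>n. real n powr (- (2 * p / (p - 2))))"
  proof (rule decay_of_weighted_energy[OF p refl s(1) _ _ th(1) q _ reg _ evU _ step])
    show "0 \<le> \<theta> * \<mu> / 2" using th \<mu> by simp
    show "\<forall>\<^sub>F n in sequentially. - (\<theta> * \<mu> / 2 * U n) \<le> B n"
      by (simp add: B_def)
  qed (use \<alpha> W0 in auto)
  moreover have "cd_rate p = (\<lambda>n. real n powr (- (2 * p / (p - 2))))"
    by (auto simp: cd_rate_def fun_eq_iff)
  ultimately show ?thesis by (simp add: W_def)
qed

text \<open>Convexity alone gives \<open>b = 1\<close> and leaves the weight exponent \<open>q = \<theta> - 2\<close>. With \<open>\<theta> = (\<alpha> - 1) / 2\<close>, forced by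
the moving projections, the requirement \<open>q > 2 * p / (p - 2) - 2\<close> is the bound on \<open>\<alpha>\<close>.\<close>

lemma cd_rate_regime_set:
  fixes F :: "'a::euclidean_space \<Rightarrow> real"
  assumes reg: "regime_set L p F" and \<alpha>: "\<alpha> > 5 + 8 / (p - 2)" and s: "0 < s" "s * L \<le> 1" and p: "p > 2"
  shows "cd_gap \<alpha> s F x0 x1 \<in> O[sequentially](cd_rate p)"
proof -
  define \<theta> where "\<theta> = (\<alpha> - 1) / 2"
  have F: "convex_smooth L F" "minimizers F \<noteq> {}" "cond_Lset p F"
    using reg by (auto simp: regime_set_def)
  have r: "2 * p / (p - 2) = 2 + 4 / (p - 2)" using p by (simp add: field_simps)
  have \<theta>: "\<theta> > 2 * p / (p - 2)" using \<alpha> by (simp add: \<theta>_def r)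
  have p0: "4 / (p - 2) > 0" "8 / (p - 2) > 0" using p by simp_all
  have "\<alpha> > 5" using \<alpha> p0(2) by linarith
  then have "\<alpha> \<ge> 3" by simp
  show ?thesis
  proof (rule cd_gap_bigo_of_scaled_energy[OF F \<open>\<alpha> \<ge> 3\<close> s p, of 1 \<theta> "\<theta> - 2"])
    show "\<forall>\<^sub>F n in sequentially. let y = cd_extrapolated \<alpha> s F x0 x1 n in 1 * (F y - min_value F)
       \<le> inner (gradient F y) (y - closest_point (minimizers F) (cd_orbit \<alpha> s F x0 x1 n))"
      using eventually_ge_at_top[of 1]
    proof eventually_elim
      case (elim n)
      have "closest_point (minimizers F) (cd_orbit \<alpha> s F x0 x1 n) \<in> minimizers F"
        using closed_convex_minimizers[OF F(1)] F(2) by (intro closest_point_in_set)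
      from min_value_eq[OF this] cd_step_ineqs(1)[OF F(1) s elim, of \<alpha> x0 x1]
      show ?case by (simp add: Let_def)
    qed
    show "\<theta> - 2 = 2 * \<theta> \<and> 2 * p / (p - 2) - 2 \<le> \<theta> - 2 \<or> 2 * p / (p - 2) - 2 < \<theta> - 2"
      using \<theta> by simp
  qed (use \<open>\<alpha> > 5\<close> in \<open>auto simp: \<theta>_def\<close>)
qed

text \<open>Flatness gives \<open>b = \<beta>\<close>. The choice \<open>\<theta> = 2 / (\<beta> - 2)\<close> is the one with \<open>\<theta> * \<beta> - 2 = 2 * \<theta>\<close>, and the
bound on \<open>\<alpha>\<close> is the condition \<open>2 * \<theta> \<le> \<alpha> - 1\<close>. As \<open>\<beta> \<le> p\<close>, the exponent \<open>q = 2 * \<theta>\<close> is at least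
\<open>4 / (p - 2) = 2 * p / (p - 2) - 2\<close>.\<close>

lemma cd_rate_regime_unique:
  fixes F :: "'a::euclidean_space \<Rightarrow> real"
  assumes reg: "regime_unique L p \<beta> F" and \<beta>: "2 < \<beta>" "\<beta> \<le> p" "\<alpha> \<ge> (\<beta> + 2) / (\<beta> - 2)"
    and \<alpha>: "\<alpha> \<ge> 3" and s: "0 < s" "s * L \<le> 1"
  shows "cd_gap \<alpha> s F x0 x1 \<in> O[sequentially](cd_rate p)"
proof -
  obtain xs where F: "convex_smooth L F" and min: "minimizers F = {xs}"
    and H: "cond_H \<beta> F xs" and L: "cond_L p F xs"
    using reg by (auto simp: regime_unique_def)
  have ne: "minimizers F \<noteq> {}" by (simp add: min)
  have p: "p > 2" using \<beta> by simp
  have infd: "infdist x (minimizers F) = norm (x - xs)" for x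
    by (simp add: min dist_norm)
  have Lset: "cond_Lset p F"
    using L unfolding cond_Lset_def cond_L_def infd .
  define x where "x = cd_orbit \<alpha> s F x0 x1"
  have lim0: "(\<lambda>n. norm (x n - xs)) \<longlonglongrightarrow> 0"
  proof -
    obtain K \<omega> where K: "K > 0" "\<omega> > 0"
      and growth: "\<And>x. F x - min_value F < \<omega> \<Longrightarrow> K * infdist x (minimizers F) powr p \<le> F x - min_value F"
      using growth_near_minimal_value[OF F ne Lset] by blast
    have gap: "cd_gap \<alpha> s F x0 x1 \<longlonglongrightarrow> 0" by (rule cd_gap_tendsto_0[OF F ne \<alpha> s])
    then have "eventually (\<lambda>n. cd_gap \<alpha> s F x0 x1 n < \<omega>) sequentially"
      using K by (simp add: order_tendstoD)
    then have "eventually (\<lambda>n. norm (x n - xs) powr p \<le> 1 / K * cd_gap \<alpha> s F x0 x1 n) sequentially"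
    proof eventually_elim
      case (elim n)
      then show ?case using growth[of "x n"] K
        by (simp add: cd_gap_def x_def infd pos_le_divide_eq mult.commute)
    qed
    moreover have "(\<lambda>n. 1 / K * cd_gap \<alpha> s F x0 x1 n) \<longlonglongrightarrow> 0"
      using tendsto_mult_left[OF gap, of "1 / K"] by simp
    ultimately have "(\<lambda>n. norm (x n - xs) powr p) \<longlonglongrightarrow> 0"
      by (intro tendsto_sandwich[of "\<lambda>_. 0" "\<lambda>n. norm (x n - xs) powr p"]) auto
    then have "(\<lambda>n. (norm (x n - xs) powr p) powr (1 / p)) \<longlonglongrightarrow> 0 powr (1 / p)"
      using p by (intro tendsto_powr') auto
    then show ?thesis using p by (simp add: powr_powr)
  qed
  have x_lim: "x \<longlonglongrightarrow> xs" using lim0 tendsto_norm_zero_iff Lim_null by blast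
  have "(\<lambda>n. x (n - 1)) \<longlonglongrightarrow> xs"
    by (rule LIMSEQ_imp_Suc) (use x_lim in simp)
  moreover have "cd_coeff \<alpha> \<longlonglongrightarrow> 1" unfolding cd_coeff_def by real_asymp
  ultimately have "cd_extrapolated \<alpha> s F x0 x1 \<longlonglongrightarrow> xs + 1 *\<^sub>R (xs - xs)"
    using x_lim unfolding cd_extrapolated_def x_def[symmetric] by (intro tendsto_intros)
  then have y_lim: "cd_extrapolated \<alpha> s F x0 x1 \<longlonglongrightarrow> xs" by simp
  obtain \<eta> where \<eta>: "\<eta> > 0" "\<And>x. norm (x - xs) \<le> \<eta> \<Longrightarrow> F x - min_value F \<le> 1 / \<beta> * inner (gradient F x) (x - xs)"
    using H unfolding cond_H_def by blast
  define \<theta> where "\<theta> = 2 / (\<beta> - 2)"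
  have \<theta>: "\<theta> > 0" "2 * \<theta> = \<theta> * \<beta> - 2" using \<beta> by (auto simp: \<theta>_def field_simps)
  have "2 * \<theta> \<le> \<alpha> - 1" using \<beta> by (simp add: \<theta>_def field_simps)
  moreover have "2 * p / (p - 2) - 2 \<le> 2 * \<theta>"
  proof -
    have "2 * p / (p - 2) - 2 = 4 / (p - 2)" using p by (simp add: field_simps)
    also have "\<dots> \<le> 4 / (\<beta> - 2)" using \<beta> by (intro divide_left_mono) auto
    finally show ?thesis by (simp add: \<theta>_def)
  qed
  moreover have "\<forall>\<^sub>F n in sequentially. let y = cd_extrapolated \<alpha> s F x0 x1 n in \<beta> * (F y - min_value F)
       \<le> inner (gradient F y) (y - closest_point (minimizers F) (cd_orbit \<alpha> s F x0 x1 n))"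
    using tendstoD[OF y_lim \<eta>(1)]
  proof eventually_elim
    case (elim n)
    have "closest_point (minimizers F) (cd_orbit \<alpha> s F x0 x1 n) = xs"
      by (simp add: min closest_point_singleton)
    then show ?case
      using \<eta>(2)[of "cd_extrapolated \<alpha> s F x0 x1 n"] elim \<beta>
      by (simp add: Let_def dist_norm field_simps)
  qed
  ultimately show ?thesis
  proof (intro cd_gap_bigo_of_scaled_energy[OF F ne Lset \<alpha> s p _ _ _ _ \<theta>(2)])
    show "1 \<le> \<beta>" "0 \<le> \<theta>" "0 < 2 * \<theta>" "2 * \<theta> \<le> 2 * \<theta>"
      using \<beta> \<theta>(1) by simp_all
  qed (use min in blast)+
qed

section \<open>The tail of a prescribed orbit\<close>

text \<open>The binomial series with its first two terms removed: \<open>Q\<close> is again a power series, hence continuously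
differentiable at \<open>0\<close>, which allows the second order quotients below to be differentiated.\<close>

lemma one_plus_powr_second_order:
  fixes \<theta> :: real
  obtains Q Q' where
    "\<And>h. \<bar>h\<bar> < 1 \<Longrightarrow> (1 + h) powr (- \<theta>) = 1 - \<theta> * h + h\<^sup>2 * Q h"
    "\<And>h. \<bar>h\<bar> < 1 \<Longrightarrow> (Q has_real_derivative Q' h) (at h)"
    "isCont Q' 0" "Q 0 = \<theta> * (\<theta> + 1) / 2"
proof -
  define c where "c n = (- \<theta> gchoose (n + 2))" for n :: nat
  define Q where "Q h = (\<Sum>n. c n * h ^ n)" for h
  define Q' where "Q' h = (\<Sum>n. diffs c n * h ^ n)" for h
  have sums: "(\<lambda>n. (- \<theta> gchoose n) * h ^ n) sums (1 + h) powr (- \<theta>)" if "\<bar>h\<bar> < 1" for h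
    by (rule gen_binomial_real[OF that])
  have sumsQ: "(\<lambda>n. h\<^sup>2 * (c n * h ^ n)) sums ((1 + h) powr (- \<theta>) - (1 - \<theta> * h))" if "\<bar>h\<bar> < 1" for h
    using sums_split_initial_segment[OF sums[OF that], of 2]
    by (simp add: c_def numeral_2_eq_2 power_add algebra_simps)
  have summ: "summable (\<lambda>n. c n * h ^ n)" if "\<bar>h\<bar> < 1" for h
  proof (cases "h = 0")
    case False
    have "summable (\<lambda>n. inverse (h\<^sup>2) * (h\<^sup>2 * (c n * h ^ n)))"
      using sumsQ[OF that] by (intro summable_mult) (auto simp: sums_iff)
    then show ?thesis using False by (simp add: mult.assoc[symmetric])
  qed (auto intro: summable_0_powser)
  show thesis
  proof
    fix h :: real assume h: "\<bar>h\<bar> < 1"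
    have "h\<^sup>2 * Q h = (1 + h) powr (- \<theta>) - (1 - \<theta> * h)"
      using sumsQ[OF h] summ[OF h] by (simp add: Q_def sums_iff suminf_mult)
    then show "(1 + h) powr (- \<theta>) = 1 - \<theta> * h + h\<^sup>2 * Q h" by simp
    show "(Q has_real_derivative Q' h) (at h)"
      unfolding Q_def Q'_def by (rule termdiffs_strong'[where K = 1]) (use summ h in auto)
  next
    have "(Q' has_real_derivative (\<Sum>n. diffs (diffs c) n * 0 ^ n)) (at 0)"
      unfolding Q'_def
      by (rule termdiffs_strong'[where K = 1]) (use termdiff_converges[of _ 1 c] summ in auto)
    then show "isCont Q' 0" by (rule DERIV_isCont)
    show "Q 0 = \<theta> * (\<theta> + 1) / 2"
    proof -
      have "Q 0 = c 0" by (simp add: Q_def powser_zero)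
      also have "\<dots> = (- \<theta>) * (- \<theta> - 1) / 2"
        by (simp add: c_def gbinomial_prod_rev numeral_2_eq_2)
      finally show ?thesis by (simp add: algebra_simps)
    qed
  qed
qed

text \<open>The prescribed orbit is \<open>x n = k powr (- \<theta>)\<close> with \<open>k = n + \<alpha> - 1\<close>. Written with \<open>h = 1 / k\<close>, where the coefficient
of the iteration is \<open>1 - \<alpha> * h\<close>, the following are its extrapolated point and the force (the derivative of the
function sought) which moves that point to the next iterate. Both make sense for all real \<open>h\<close> in \<open>{0..<1}\<close>, so
that \<open>h\<close> parametrizes the graph of a force through all the prescribed points.\<close>

definition cd_tail_point :: "real \<Rightarrow> real \<Rightarrow> real \<Rightarrow> real" where
  "cd_tail_point \<alpha> \<theta> h = h powr \<theta> * (1 + (1 - \<alpha> * h) * (1 - (1 - h) powr (- \<theta>)))"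

definition cd_tail_force :: "real \<Rightarrow> real \<Rightarrow> real \<Rightarrow> real \<Rightarrow> real" where
  "cd_tail_force \<alpha> \<theta> s h = (cd_tail_point \<alpha> \<theta> h - h powr \<theta> * (1 + h) powr (- \<theta>)) / s"

text \<open>Up to the powers \<open>h powr \<theta>\<close> and \<open>h powr (\<theta> + 2)\<close>, point and force are functions \<open>A\<close> and \<open>B / s\<close> that are
continuously differentiable at \<open>0\<close>, with \<open>A 0 = 1\<close> and \<open>B 0 = \<theta> * (\<alpha> - 1 - \<theta>) > 0\<close>. Hence for small \<open>h\<close> the force varies much less
than the point, which gives the Lipschitz bound. The powers of \<open>h\<close> cancel in the ratio of
the force to the \<open>(p - 1)\<close>-th power of the point, because \<open>\<theta> * (p - 1) = \<theta> + 2\<close>; at \<open>0\<close> the ratio is increasing since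
\<open>B' 0 > 0\<close> and \<open>A' 0 < 0\<close>. The monotone ratio yields the flatness condition for the exponent \<open>p\<close> itself, without
any loss.

The last conclusion compares two consecutive values of \<open>(x (n - 1) - x n) / k\<close>. It is what allows the tail to be
joined to an initial phase under constant force.\<close>

lemma cd_tail_properties:
  fixes \<alpha> \<theta> p L s :: real
  assumes p: "p > 2" and th: "\<theta> = 2 / (p - 2)" and \<alpha>: "\<alpha> > 1 + \<theta>" and L: "L > 0" and s: "s > 0"
  defines "Y \<equiv> cd_tail_point \<alpha> \<theta>" and "G \<equiv> cd_tail_force \<alpha> \<theta> s"
  obtains h1 c where "0 < h1" "h1 < 1" "c > 0"
    "\<And>a b. 0 \<le> a \<Longrightarrow> a < b \<Longrightarrow> b \<le> h1 \<Longrightarrow> Y a < Y b"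
    "continuous_on {0..h1} Y"
    "\<And>a b. 0 \<le> a \<Longrightarrow> a \<le> b \<Longrightarrow> b \<le> h1 \<Longrightarrow> G a \<le> G b \<and> G b - G a \<le> L * (Y b - Y a)"
    "\<And>a b. 0 < a \<Longrightarrow> a \<le> b \<Longrightarrow> b \<le> h1 \<Longrightarrow> G a / Y a powr (p - 1) \<le> G b / Y b powr (p - 1)"
    "((\<lambda>h. G h / Y h powr (p - 1)) \<longlongrightarrow> c) (at_right 0)"
    "\<And>h. 0 < h \<Longrightarrow> h \<le> h1 \<Longrightarrow>
      (let e = h * (h powr \<theta> * ((1 - h) powr (- \<theta>) - 1));
           e' = h / (1 + h) * (h powr \<theta> * (1 - (1 + h) powr (- \<theta>)))
       in e' \<le> e \<and> e - e' \<le> s * L * e)"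
proof -
  have th0: "\<theta> > 0" using p th by simp
  have thp: "\<theta> * (p - 1) = \<theta> + 2" using p by (simp add: th field_simps)
  obtain Q Q' where
    Q: "\<And>h. \<bar>h\<bar> < 1 \<Longrightarrow> (1 + h) powr (- \<theta>) = 1 - \<theta> * h + h\<^sup>2 * Q h" and
    dQ: "\<And>h. \<bar>h\<bar> < 1 \<Longrightarrow> (Q has_real_derivative Q' h) (at h)" and
    cQ': "isCont Q' 0" and Q0: "Q 0 = \<theta> * (\<theta> + 1) / 2"
    using one_plus_powr_second_order by blast
  have cQ: "isCont Q 0" using dQ[of 0] by (auto intro: DERIV_isCont)
  have cQm: "isCont (\<lambda>h. Q (- h)) 0" "isCont (\<lambda>h. Q' (- h)) 0"
    using isCont_o2[of 0 uminus Q] isCont_o2[of 0 uminus Q'] cQ cQ' by auto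
  define A where "A h = 1 - \<theta> * h + \<alpha> * \<theta> * h\<^sup>2 - (1 - \<alpha> * h) * h\<^sup>2 * Q (- h)" for h
  define A' where "A' h = - \<theta> + 2 * \<alpha> * \<theta> * h + \<alpha> * h\<^sup>2 * Q (- h) - (1 - \<alpha> * h) * (2 * h) * Q (- h)
      + (1 - \<alpha> * h) * h\<^sup>2 * Q' (- h)" for h
  define B where "B h = \<alpha> * \<theta> - (1 - \<alpha> * h) * Q (- h) - Q h" for h
  define B' where "B' h = \<alpha> * Q (- h) + (1 - \<alpha> * h) * Q' (- h) - Q' h" for h
  have dQm: "((\<lambda>h. Q (- h)) has_real_derivative - Q' (- h)) (at h)" if "\<bar>h\<bar> < 1" for h
    using DERIV_chain2[of Q "Q' (- h)" uminus h "-1" UNIV] dQ[of "- h"] that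
    by (simp add: DERIV_minus DERIV_ident)
  have dA: "(A has_real_derivative A' h) (at h)" if "\<bar>h\<bar> < 1" for h
    unfolding A_def A'_def
    by (rule derivative_eq_intros dQm[OF that] refl | simp)+ (simp add: algebra_simps)
  have dB: "(B has_real_derivative B' h) (at h)" if "\<bar>h\<bar> < 1" for h
    unfolding B_def B'_def
    by (rule derivative_eq_intros dQm[OF that] dQ[OF that] refl | simp)+
  have Y_eq: "Y h = h powr \<theta> * A h" if "\<bar>h\<bar> < 1" for h
  proof -
    have "(1 - h) powr (- \<theta>) = 1 + \<theta> * h + h\<^sup>2 * Q (- h)" using Q[of "- h"] that by simp
    then show ?thesis
      unfolding Y_def cd_tail_point_def A_def by (simp add: algebra_simps power2_eq_square)
  qed
  have G_eq: "G h = h powr \<theta> * (h\<^sup>2 * B h) / s" if "\<bar>h\<bar> < 1" for h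
  proof -
    have "A h - (1 + h) powr (- \<theta>) = h\<^sup>2 * B h"
      using Q[OF that] by (simp add: A_def B_def algebra_simps power2_eq_square)
    then show ?thesis
      unfolding G_def cd_tail_force_def Y_def[symmetric] Y_eq[OF that] by (simp flip: right_diff_distrib)
  qed
  define B0 where "B0 = \<theta> * (\<alpha> - 1 - \<theta>)"
  have B0: "B0 > 0" using \<alpha> th0 by (simp add: B0_def)
  have B_0: "B 0 = B0" by (simp add: B_def Q0 B0_def field_simps)
  have pos0: "A 0 = 1" "A' 0 = - \<theta>" "B' 0 = \<alpha> * Q 0"
    by (simp_all add: A_def A'_def B'_def)
  have Q00: "Q 0 > 0" using th0 by (simp add: Q0)
  have cA: "isCont A 0" and cB: "isCont B 0"
    using dA[of 0] dB[of 0] by (auto intro: DERIV_isCont)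
  have cA': "isCont A' 0" and cB': "isCont B' 0"
    unfolding A'_def B'_def by (intro continuous_intros cQ cQ' cQm)+
  \<comment> \<open>each condition becomes positivity at \<open>0\<close> of a continuous function\<close>
  \<comment> \<open>C1, C2 come from the derivatives of point and force, C3 from the Lipschitz bound, C4 from the ratio,
    C5, C6 from the comparison of consecutive values\<close>
  define C1 where "C1 h = \<theta> * A h + h * A' h" for h
  define C2 where "C2 h = (\<theta> + 2) * B h + h * B' h" for h
  define C3 where "C3 h = s * L * C1 h - h\<^sup>2 * C2 h" for h
  define C4 where "C4 h = B' h * A h - (p - 1) * B h * A' h" for h
  define C5 where "C5 h = \<theta> + (1 + h) * Q (- h) + Q h" for h
  define C6 where "C6 h = \<theta> - h * Q h - (1 - s * L) * ((1 + h) * (\<theta> + h * Q (- h)))" for h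
  have "isCont C1 0" "isCont C2 0" "isCont C3 0" "isCont C4 0" "isCont C5 0" "isCont C6 0"
    unfolding C1_def C2_def C3_def C4_def C5_def C6_def
    by (intro continuous_intros cA cB cA' cB' cQ cQm)+
  moreover have "C1 0 > 0" using th0 by (simp add: C1_def pos0)
  moreover have "C2 0 > 0" using th0 B0 by (simp add: C2_def B_0)
  moreover have "C3 0 > 0" using th0 L s by (simp add: C3_def C1_def pos0)
  moreover have "C4 0 > 0"
  proof -
    have "C4 0 = \<alpha> * Q 0 + (p - 1) * B0 * \<theta>" by (simp add: C4_def pos0 B_0)
    also have "\<dots> > 0" using th0 B0 Q00 \<alpha> p by (intro add_pos_pos mult_pos_pos) auto
    finally show ?thesis .
  qed
  moreover have "C5 0 > 0" using th0 Q00 by (simp add: C5_def)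
  moreover have "C6 0 > 0" using th0 L s by (simp add: C6_def algebra_simps)
  moreover have "A 0 > 0" by (simp add: pos0)
  moreover note cA
  ultimately have "\<forall>\<^sub>F h in nhds 0. C1 h > 0 \<and> C2 h > 0 \<and> C3 h > 0 \<and> C4 h > 0 \<and> C5 h > 0 \<and> C6 h > 0 \<and> A h > 0"
    unfolding isCont_def tendsto_at_iff_tendsto_nhds
    by (auto intro!: eventually_conj order_tendstoD(1))
  then obtain d where d: "d > 0" and dpos: "\<And>h. \<bar>h\<bar> < d \<Longrightarrow>
      C1 h > 0 \<and> C2 h > 0 \<and> C3 h > 0 \<and> C4 h > 0 \<and> C5 h > 0 \<and> C6 h > 0 \<and> A h > 0"
    unfolding eventually_nhds_metric dist_real_def by auto
  define h1 where "h1 = min d 1 / 2"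
  have h1: "h1 > 0" "h1 < 1" and h1d: "h1 < d" using d by (auto simp: h1_def)
  have pos: "C1 h > 0 \<and> C2 h > 0 \<and> C3 h > 0 \<and> C4 h > 0 \<and> C5 h > 0 \<and> C6 h > 0 \<and> A h > 0 \<and> \<bar>h\<bar> < 1"
    if "0 \<le> h" "h \<le> h1" for h
    using dpos[of h] that h1 h1d by auto
  define YA where "YA h = h powr \<theta> * A h" for h
  define GB where "GB h = h powr \<theta> * (h\<^sup>2 * B h) / s" for h
  have cAB: "continuous_on {0..h1} A" "continuous_on {0..h1} B"
    using DERIV_isCont[OF dA] DERIV_isCont[OF dB] pos
    by (auto intro!: continuous_at_imp_continuous_on)
  have cP: "continuous_on {0..h1} (\<lambda>h. h powr \<theta>)"
    using th0 by (intro continuous_on_powr') (auto intro: continuous_intros)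
  have cont: "continuous_on {0..h1} YA" "continuous_on {0..h1} GB"
    unfolding YA_def GB_def using s by (intro continuous_intros cAB cP; simp)+
  have dYA: "(YA has_real_derivative h powr (\<theta> - 1) * C1 h) (at h)" if "0 < h" "h \<le> h1" for h
  proof -
    have h: "\<bar>h\<bar> < 1" using that h1 by simp
    have "(YA has_real_derivative (\<theta> * h powr (\<theta> - 1) * A h + h powr \<theta> * A' h)) (at h)"
      unfolding YA_def
      by (rule derivative_eq_intros dA[OF h] has_real_derivative_powr[OF that(1)] refl | simp)+
    moreover have "h powr \<theta> = h powr (\<theta> - 1) * h" using that by (simp add: powr_diff)
    ultimately show ?thesis by (simp add: C1_def algebra_simps)
  qed
  have dGB: "(GB has_real_derivative h powr (\<theta> - 1) * (h\<^sup>2 * C2 h) / s) (at h)" if "0 < h" "h \<le> h1" for h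
  proof -
    have h: "\<bar>h\<bar> < 1" using that h1 by simp
    have "(GB has_real_derivative (\<theta> * h powr (\<theta> - 1) * (h\<^sup>2 * B h)
        + h powr \<theta> * (2 * h * B h + h\<^sup>2 * B' h)) / s) (at h)"
    proof -
      have sq: "((\<lambda>h::real. h\<^sup>2) has_real_derivative 2 * h) (at h)"
        by (auto intro!: derivative_eq_intros)
      show ?thesis
        using DERIV_cdivide[OF DERIV_mult[OF has_real_derivative_powr[OF that(1), of \<theta>]
            DERIV_mult[OF sq dB[OF h]]], of s]
        by (simp add: GB_def[abs_def] algebra_simps)
    qed
    moreover have "h powr \<theta> = h powr (\<theta> - 1) * h" using that by (simp add: powr_diff)
    ultimately show ?thesis by (simp add: C2_def algebra_simps power2_eq_square)
  qed
  have YY: "Y h = YA h" and GG: "G h = GB h" if "0 \<le> h" "h \<le> h1" for h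
    using Y_eq[of h] G_eq[of h] that h1 by (auto simp: YA_def GB_def)
  have ratio: "G h / Y h powr (p - 1) = B h * A h powr (- (p - 1)) / s" if "0 < h" "h \<le> h1" for h
  proof -
    have A: "A h > 0" using pos[of h] that by simp
    have "(h powr \<theta> * A h) powr (p - 1) = h powr (\<theta> * (p - 1)) * A h powr (p - 1)"
      by (simp add: powr_mult powr_powr)
    also have "h powr (\<theta> * (p - 1)) = h powr \<theta> * h\<^sup>2"
      using that by (simp add: thp powr_add powr_numeral)
    finally show ?thesis
      using that A s unfolding powr_minus_divide by (simp add: YY GG YA_def GB_def)
  qed
  show thesis
  proof (rule that[OF h1, of "B0 / s"])
    show "B0 / s > 0" using B0 s by simp
  next
    fix a b assume ab: "0 \<le> a" "a < b" "b \<le> h1"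
    have "YA a < YA b"
    proof (rule DERIV_pos_imp_increasing_open[OF ab(2)])
      fix x assume x: "a < x" "x < b"
      show "\<exists>y. DERIV YA x :> y \<and> 0 < y"
        using dYA[of x] pos[of x] x ab by (intro exI conjI) auto
    qed (use ab in \<open>auto intro: continuous_on_subset[OF cont(1)]\<close>)
    then show "Y a < Y b" using ab by (simp add: YY)
  next
    show "continuous_on {0..h1} Y"
      using cont(1) by (rule continuous_on_eq) (simp add: YY)
  next
    fix a b assume ab: "0 \<le> a" "a \<le> b" "b \<le> h1"
    have "GB a \<le> GB b"
    proof (rule DERIV_nonneg_imp_increasing_open[OF ab(2)])
      fix x assume x: "a < x" "x < b"
      have "0 \<le> x powr (\<theta> - 1) * (x\<^sup>2 * C2 x) / s" using pos[of x] x ab s by simp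
      then show "\<exists>y. DERIV GB x :> y \<and> 0 \<le> y"
        using dGB[of x] x ab by force
    qed (use ab in \<open>auto intro: continuous_on_subset[OF cont(2)]\<close>)
    moreover have "L * YA a - GB a \<le> L * YA b - GB b"
    proof (rule DERIV_nonneg_imp_increasing_open[OF ab(2)])
      fix x assume x: "a < x" "x < b"
      have "((\<lambda>h. L * YA h - GB h) has_real_derivative
          (L * (x powr (\<theta> - 1) * C1 x) - x powr (\<theta> - 1) * (x\<^sup>2 * C2 x) / s)) (at x)"
        using x ab by (intro DERIV_diff DERIV_cmult dYA dGB) auto
      moreover have "L * (x powr (\<theta> - 1) * C1 x) - x powr (\<theta> - 1) * (x\<^sup>2 * C2 x) / s
          = x powr (\<theta> - 1) * (C3 x / s)"
        using s by (simp add: C3_def field_simps)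
      moreover have "\<dots> \<ge> 0" using pos[of x] x ab s by simp
      ultimately show "\<exists>y. DERIV (\<lambda>h. L * YA h - GB h) x :> y \<and> 0 \<le> y" by metis
    qed (use ab in \<open>auto intro!: continuous_intros intro: continuous_on_subset[OF cont(2)]
        continuous_on_subset[OF cont(1)]\<close>)
    ultimately show "G a \<le> G b \<and> G b - G a \<le> L * (Y b - Y a)"
      using ab by (simp add: YY GG algebra_simps)
  next
    fix a b assume ab: "0 < a" "a \<le> b" "b \<le> h1"
    have "B a * A a powr (- (p - 1)) \<le> B b * A b powr (- (p - 1))"
    proof (rule DERIV_nonneg_imp_nondecreasing[OF ab(2)])
      fix x assume x: "a \<le> x" "x \<le> b"
      have x1: "\<bar>x\<bar> < 1" and A: "A x > 0" using pos[of x] x ab by auto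
      have "((\<lambda>h. B h * A h powr (- (p - 1))) has_real_derivative
          (B' x * A x powr (- (p - 1)) + B x * (- (p - 1) * A x powr (- (p - 1) - 1) * A' x))) (at x)"
        using A by (auto intro!: derivative_eq_intros dA[OF x1] dB[OF x1])
      moreover have "A x powr (- (p - 1)) = A x powr (- (p - 1) - 1) * A x"
        using A powr_add[of "A x" "- (p - 1) - 1" 1] by simp
      then have "B' x * A x powr (- (p - 1)) + B x * (- (p - 1) * A x powr (- (p - 1) - 1) * A' x)
          = A x powr (- (p - 1) - 1) * C4 x"
        unfolding C4_def by (simp add: algebra_simps)
      moreover have "\<dots> \<ge> 0" using pos[of x] x ab by simp
      ultimately show "\<exists>y. DERIV (\<lambda>h. B h * A h powr (- (p - 1))) x :> y \<and> 0 \<le> y" by metis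
    qed
    then show "G a / Y a powr (p - 1) \<le> G b / Y b powr (p - 1)"
      using ab s by (simp add: ratio divide_right_mono)
  next
    have "((\<lambda>h. B h * A h powr (- (p - 1)) / s) \<longlongrightarrow> B 0 * A 0 powr (- (p - 1)) / s) (at_right 0)"
      using cA cB s pos0 unfolding isCont_def
      by (intro tendsto_intros) (auto intro: filterlim_mono[OF _ order_refl at_le])
    moreover have "\<forall>\<^sub>F h in at_right 0. B h * A h powr (- (p - 1)) / s = G h / Y h powr (p - 1)"
      unfolding eventually_at_right_field using h1 ratio by (intro exI[of _ h1]) auto
    ultimately show "((\<lambda>h. G h / Y h powr (p - 1)) \<longlongrightarrow> B0 / s) (at_right 0)"
      by (simp add: B_0 pos0 Lim_transform_eventually)
  next
    fix h assume h: "0 < h" "h \<le> h1"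
    define w where "w = h * (h * h powr \<theta>) / (1 + h)"
    have w: "w > 0" using h by (simp add: w_def)
    have "(1 - h) powr (- \<theta>) - 1 = h * (\<theta> + h * Q (- h))"
      using Q[of "- h"] h h1 by (simp add: algebra_simps power2_eq_square)
    then have e: "h * (h powr \<theta> * ((1 - h) powr (- \<theta>) - 1)) = w * ((1 + h) * (\<theta> + h * Q (- h)))"
      using h by (simp add: w_def)
    have "1 - (1 + h) powr (- \<theta>) = h * (\<theta> - h * Q h)"
      using Q[of h] h h1 by (simp add: algebra_simps power2_eq_square)
    then have e': "h / (1 + h) * (h powr \<theta> * (1 - (1 + h) powr (- \<theta>))) = w * (\<theta> - h * Q h)"
      using h by (simp add: w_def)
    have "w * ((1 + h) * (\<theta> + h * Q (- h))) - w * (\<theta> - h * Q h) = w * (h * C5 h)"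
      by (simp add: C5_def algebra_simps)
    moreover have "\<dots> \<ge> 0" using pos[of h] h w by simp
    moreover have "s * L * (w * ((1 + h) * (\<theta> + h * Q (- h))))
        - (w * ((1 + h) * (\<theta> + h * Q (- h))) - w * (\<theta> - h * Q h)) = w * C6 h"
      by (simp add: C6_def algebra_simps)
    moreover have "w * C6 h \<ge> 0" using pos[of h] h w by simp
    ultimately show "let e = h * (h powr \<theta> * ((1 - h) powr (- \<theta>) - 1));
           e' = h / (1 + h) * (h powr \<theta> * (1 - (1 + h) powr (- \<theta>)))
       in e' \<le> e \<and> e - e' \<le> s * L * e"
      unfolding Let_def e e' by linarith
  qed
qed

section \<open>A force with a prescribed orbit\<close>

text \<open>The extrapolation coefficient vanishes in the first step, so an orbit is determined by \<open>x 1\<close> alone, and two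
consecutive points of the tail cannot be taken as its start. Therefore the tail is preceded by a phase in which the force is constant, equal to \<open>\<Gamma>\<close>.
Under constant force the velocity \<open>x (n - 1) - x n\<close> is \<open>(n + \<alpha> - 1) * e\<close> with \<open>e = s * \<Gamma> / (\<alpha> + 1)\<close>; choosing \<open>\<Gamma>\<close> to
match the velocity of the tail at an index \<open>n0\<close> glues both phases. The force on the tail is read off from
its parametrization, and between the last point of the initial phase and the first point of the tail it
is continued with slope \<open>L\<close> up to the value \<open>\<Gamma>\<close>, which is reached in time if \<open>n0\<close> is large.\<close>

lemma one_dimensional_inverse_design:
  fixes \<alpha> \<theta> p L s :: real
  assumes p: "p > 2" and th: "\<theta> = 2 / (p - 2)" and \<alpha>: "\<alpha> > 1 + \<theta>" and L: "L > 0" and s: "s > 0"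
  obtains g :: "real \<Rightarrow> real" and \<xi> :: "nat \<Rightarrow> real" and c Y0 :: real
  where "c > 0" "Y0 > 0" "g 0 = 0" "\<And>y. g (- y) = - g y"
    "\<And>a b. a \<le> b \<Longrightarrow> g a \<le> g b \<and> g b - g a \<le> L * (b - a)"
    "\<And>a b. 0 < a \<Longrightarrow> a \<le> b \<Longrightarrow> b \<le> Y0 \<Longrightarrow> g a / a powr (p - 1) \<le> g b / b powr (p - 1)"
    "((\<lambda>y. g y / y powr (p - 1)) \<longlongrightarrow> c) (at_right 0)"
    "\<And>n. n \<ge> 1 \<Longrightarrow> let y = \<xi> n + cd_coeff \<alpha> n * (\<xi> n - \<xi> (n - 1)) in \<xi> (Suc n) = y - s * g y"
    "\<forall>\<^sub>F n in sequentially. \<xi> n = (real n + \<alpha> - 1) powr (- \<theta>)"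
proof -
  have th0: "\<theta> > 0" using p th by simp
  define Y where "Y = cd_tail_point \<alpha> \<theta>"
  define G where "G = cd_tail_force \<alpha> \<theta> s"
  obtain h1 c where h1: "0 < h1" "h1 < 1" and c: "c > 0"
    and Ym: "\<And>a b. 0 \<le> a \<Longrightarrow> a < b \<Longrightarrow> b \<le> h1 \<Longrightarrow> Y a < Y b"
    and Yc: "continuous_on {0..h1} Y"
    and GL: "\<And>a b. 0 \<le> a \<Longrightarrow> a \<le> b \<Longrightarrow> b \<le> h1 \<Longrightarrow> G a \<le> G b \<and> G b - G a \<le> L * (Y b - Y a)"
    and Gm: "\<And>a b. 0 < a \<Longrightarrow> a \<le> b \<Longrightarrow> b \<le> h1 \<Longrightarrow> G a / Y a powr (p - 1) \<le> G b / Y b powr (p - 1)"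
    and Gc: "((\<lambda>h. G h / Y h powr (p - 1)) \<longlongrightarrow> c) (at_right 0)"
    and junction: "\<And>h. 0 < h \<Longrightarrow> h \<le> h1 \<Longrightarrow>
      (let e = h * (h powr \<theta> * ((1 - h) powr (- \<theta>) - 1));
           e' = h / (1 + h) * (h powr \<theta> * (1 - (1 + h) powr (- \<theta>)))
       in e' \<le> e \<and> e - e' \<le> s * L * e)"
    using cd_tail_properties[OF p th \<alpha> L s, folded Y_def G_def] by blast
  define n0 where "n0 = nat \<lceil>1 / h1\<rceil> + 2"
  define k where "k n = real n + \<alpha> - 1" for n :: nat
  define K where "K = k n0"
  define h0 where "h0 = 1 / K"
  define X where "X t = t powr (- \<theta>)" for t :: real
  have K: "K \<ge> 1 / h1" "K > 2" using \<alpha> th0 by (auto simp: K_def k_def n0_def) linarith+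
  have h0: "0 < h0" "h0 \<le> h1" using K h1 by (auto simp: h0_def field_simps)
  have k_K: "k n \<ge> K" if "n \<ge> n0" for n using that by (simp add: k_def K_def)
  have X_h: "X t = (1 / t) powr \<theta>" "X (t - 1) = (1 / t) powr \<theta> * (1 - 1 / t) powr (- \<theta>)"
      "X (t + 1) = (1 / t) powr \<theta> * (1 + 1 / t) powr (- \<theta>)" if "t > 1" for t
  proof -
    have "t - 1 = t * (1 - 1 / t)" "t + 1 = t * (1 + 1 / t)" using that by (auto simp: field_simps)
    moreover show "X t = (1 / t) powr \<theta>" using that by (simp add: X_def powr_minus_divide powr_divide)
    ultimately show "X (t - 1) = (1 / t) powr \<theta> * (1 - 1 / t) powr (- \<theta>)"
      "X (t + 1) = (1 / t) powr \<theta> * (1 + 1 / t) powr (- \<theta>)"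
      using that by (simp_all only: X_def powr_mult)
  qed
  have Y_k: "Y (1 / t) = X t - (1 - \<alpha> / t) * (X (t - 1) - X t)" if "t > 1" for t
    unfolding Y_def cd_tail_point_def X_h[OF that] by (simp add: algebra_simps)
  have G_k: "s * G (1 / t) = Y (1 / t) - X (t + 1)" if "t > 1" for t
    unfolding G_def cd_tail_force_def X_h(3)[OF that] Y_def[symmetric] using s by simp
  define e where "e = (X (K - 1) - X K) / K"
  define \<Gamma> where "\<Gamma> = (\<alpha> + 1) * e / s"
  define Y0 where "Y0 = Y h0"
  \<comment> \<open>\<open>Y0\<close> is the extrapolated point of index \<open>n0\<close>, \<open>Y1\<close> that of index \<open>n0 - 1\<close>\<close>
  define Y1 where "Y1 = X K + (\<alpha> + 1) * e"
  have Y_0: "Y 0 = 0" by (simp add: Y_def cd_tail_point_def)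
  have G_0: "G 0 = 0" by (simp add: G_def cd_tail_force_def Y_def[symmetric] Y_0)
  have Y0: "Y0 > 0" using Ym[of 0 h0] h0 by (simp add: Y0_def Y_0)
  have e0: "e > 0"
  proof -
    have "X K < X (K - 1)"
      unfolding X_def using K th0 by (intro powr_less_mono2_neg) auto
    then show ?thesis using K by (simp add: e_def)
  qed
  have Y1_Y0: "Y1 - Y0 = (K + 1) * e"
  proof -
    have "(1 - \<alpha> / K) * (X (K - 1) - X K) = (K - \<alpha>) * e" using K by (simp add: e_def field_simps)
    then have "Y0 = X K - (K - \<alpha>) * e" using Y_k[of K] K by (simp add: Y0_def h0_def)
    then show ?thesis by (simp add: Y1_def algebra_simps)
  qed
  have \<Gamma>: "G h0 \<le> \<Gamma>" "\<Gamma> - G h0 \<le> L * (Y1 - Y0)"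
  proof -
    define e' where "e' = (X K - X (K + 1)) / (K + 1)"
    have "e' = h0 / (1 + h0) * (h0 powr \<theta> * (1 - (1 + h0) powr (- \<theta>)))"
      using K unfolding e'_def h0_def X_h[of K, OF less_trans[OF _ K(2)], simplified]
      by (simp add: field_simps)
    moreover have "e = h0 * (h0 powr \<theta> * ((1 - h0) powr (- \<theta>) - 1))"
      using K unfolding e_def h0_def X_h[of K, OF less_trans[OF _ K(2)], simplified]
      by (simp add: field_simps)
    ultimately have ee: "e' \<le> e" "e - e' \<le> s * L * e"
      using junction[OF h0] by (simp_all add: Let_def)
    have "s * (\<Gamma> - G h0) = (\<alpha> + 1) * e - (Y0 - X (K + 1))"
      using G_k[of K] K s by (simp add: \<Gamma>_def right_diff_distrib h0_def Y0_def)
    also have "\<dots> = (K + 1) * e - (X K - X (K + 1))"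
      using Y1_Y0 by (simp add: Y1_def)
    also have "X K - X (K + 1) = (K + 1) * e'" using K by (simp add: e'_def)
    also have "(K + 1) * e - (K + 1) * e' = (K + 1) * (e - e')" by (simp add: right_diff_distrib)
    finally have eq: "s * (\<Gamma> - G h0) = (K + 1) * (e - e')" .
    have "0 \<le> (K + 1) * (e - e')" using ee K by simp
    then have "0 \<le> \<Gamma> - G h0" using s unfolding eq[symmetric] by (simp add: zero_le_mult_iff)
    then show "G h0 \<le> \<Gamma>" by simp
    have "s * (\<Gamma> - G h0) \<le> (K + 1) * (s * L * e)"
      unfolding eq using ee K by (intro mult_left_mono) auto
    also have "\<dots> = s * (L * (Y1 - Y0))" by (simp add: Y1_Y0)
    finally show "\<Gamma> - G h0 \<le> L * (Y1 - Y0)" using s by simp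
  qed
  have Yle: "Y a \<le> Y b \<longleftrightarrow> a \<le> b" if "0 \<le> a" "0 \<le> b" "a \<le> h0" "b \<le> h0" for a b
    using Ym[of a b] Ym[of b a] that h0 by (cases a b rule: linorder_cases) auto
  have inj: "inj_on Y {0..h0}" by (rule inj_onI) (metis Yle atLeastAtMost_iff order_antisym order_refl)
  define \<phi> where "\<phi> = the_inv_into {0..h0} Y"
  have \<phi>Y: "\<phi> (Y h) = h" if "0 \<le> h" "h \<le> h0" for h
    unfolding \<phi>_def using that by (intro the_inv_into_f_f[OF inj]) auto
  have \<phi>: "0 \<le> \<phi> y \<and> \<phi> y \<le> h0 \<and> Y (\<phi> y) = y" if y: "0 \<le> y" "y \<le> Y0" for y
  proof -
    have "\<exists>h\<ge>0. h \<le> h0 \<and> Y h = y"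
      by (rule IVT') (use y h0 Y_0 in \<open>auto simp: Y0_def intro: continuous_on_subset[OF Yc]\<close>)
    then show ?thesis using \<phi>Y by auto
  qed
  define g0 where "g0 y = (if y \<le> Y0 then G (\<phi> y) else min \<Gamma> (G h0 + L * (y - Y0)))" for y
  have g0_Y: "g0 (Y h) = G h" if "0 \<le> h" "h \<le> h0" for h
    using that Yle[of h h0] h0 by (simp add: g0_def Y0_def \<phi>Y)
  have g0_0: "g0 0 = 0" using g0_Y[of 0] h0 by (simp add: Y_0 G_0)
  have g0_hi: "g0 y = min \<Gamma> (G h0 + L * (y - Y0))" if "Y0 \<le> y" for y
    using that \<Gamma>(1) g0_Y[of h0] h0 by (cases "y = Y0") (auto simp: g0_def Y0_def)
  have g0_lo: "g0 a \<le> g0 b \<and> g0 b - g0 a \<le> L * (b - a)" if "0 \<le> a" "a \<le> b" "b \<le> Y0" for a b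
    using GL[of "\<phi> a" "\<phi> b"] \<phi>[of a] \<phi>[of b] that h0 Yle[of "\<phi> a" "\<phi> b"] by (simp add: g0_def)
  have g0_up: "g0 a \<le> g0 b \<and> g0 b - g0 a \<le> L * (b - a)" if "Y0 \<le> a" "a \<le> b" for a b
  proof -
    have "L * (a - Y0) \<le> L * (b - Y0)" using L that by simp
    then show ?thesis using that by (simp add: g0_hi min_def right_diff_distrib)
  qed
  have g0: "g0 a \<le> g0 b \<and> g0 b - g0 a \<le> L * (b - a)" if "0 \<le> a" "a \<le> b" for a b
  proof (cases "b \<le> Y0 \<or> Y0 \<le> a")
    case True then show ?thesis using g0_lo g0_up that by blast
  next
    case False
    then show ?thesis using g0_lo[of a Y0] g0_up[of Y0 b] that Y0 by (simp add: right_diff_distrib)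
  qed
  define g where "g y = sgn y * g0 \<bar>y\<bar>" for y
  have g_pos: "g y = g0 y" if "y \<ge> 0" for y using that g0_0 by (auto simp: g_def sgn_if)
  have g_odd: "g (- y) = - g y" for y by (simp add: g_def sgn_minus)
  have g_lip: "g a \<le> g b \<and> g b - g a \<le> L * (b - a)" if "a \<le> b" for a b
  proof -
    consider "0 \<le> a" | "b \<le> 0" | "a < 0" "0 < b" using that by linarith
    then show ?thesis
    proof cases
      case 1 then show ?thesis using g0[of a b] that by (simp add: g_pos)
    next
      case 2 then show ?thesis using g0[of "- b" "- a"] that g_pos[of "- a"] g_pos[of "- b"]
        by (simp add: g_odd)
    next
      case 3 then show ?thesis using g0[of 0 "- a"] g0[of 0 b] g_pos[of "- a"] g_pos[of b]
        by (simp add: g_odd g0_0 right_diff_distrib)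
    qed
  qed
  have g_ratio: "g y / y powr (p - 1) = G (\<phi> y) / Y (\<phi> y) powr (p - 1)" if "0 \<le> y" "y \<le> Y0" for y
    using \<phi>[OF that] that by (simp add: g_pos g0_def)
  have \<phi>pos: "\<phi> y > 0" if "0 < y" "y \<le> Y0" for y
    using \<phi>[of y] that Y_0 by (cases "\<phi> y = 0") auto
  \<comment> \<open>the second branch sums the linearly growing velocities of the initial phase\<close>
  define \<xi> where "\<xi> n = (if n + 1 \<ge> n0 then X (k n) else X K + e * (K * (K + 1) - k n * (k n + 1)) / 2)"
    for n :: nat
  have \<xi>_tail: "\<xi> n = X (k n)" if "n + 1 \<ge> n0" for n using that by (simp add: \<xi>_def)
  \<comment> \<open>both formulas agree at \<open>n0 - 1\<close> and \<open>n0\<close>, the two positions that start the tail\<close>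
  have \<xi>_early: "\<xi> n = X K + e * (K * (K + 1) - k n * (k n + 1)) / 2" if "n \<le> n0" for n
  proof -
    have "n0 \<ge> 2" by (simp add: n0_def)
    moreover have "n + 1 < n0 \<or> n = n0 - 1 \<or> n = n0" using that by arith
    ultimately consider "n + 1 < n0" | "n = n0 - 1" "n0 \<ge> 2" | "n = n0" by blast
    then show ?thesis
    proof cases
      case 2
      then have kn: "k n = K - 1" by (simp add: K_def k_def of_nat_diff)
      have "X (K - 1) = X K + e * K" using K by (simp add: e_def)
      moreover have "n + 1 \<ge> n0" using 2 by simp
      then have "\<xi> n = X (K - 1)" by (simp add: \<xi>_tail kn)
      moreover have "e * (K * (K + 1) - (K - 1) * (K - 1 + 1)) / 2 = e * K" by (simp add: field_simps)
      ultimately show ?thesis by (simp only: kn)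
    qed (auto simp: \<xi>_def K_def)
  qed
  have rec: "let y = \<xi> n + cd_coeff \<alpha> n * (\<xi> n - \<xi> (n - 1)) in \<xi> (Suc n) = y - s * g y" if n: "n \<ge> 1" for n
  proof -
    define y where "y = \<xi> n + cd_coeff \<alpha> n * (\<xi> n - \<xi> (n - 1))"
    have k1: "k n > 1" using n \<alpha> th0 by (simp add: k_def)
    have co: "cd_coeff \<alpha> n = 1 - \<alpha> / k n"
      using k1 by (simp add: cd_coeff_def k_def field_simps)
    have kS: "k (Suc n) = k n + 1" "k (n - 1) = k n - 1" using n by (auto simp: k_def of_nat_diff)
    have "\<xi> (Suc n) = y - s * g y"
    proof (cases "n \<ge> n0")
      case True
      then have "\<xi> n = X (k n)" "\<xi> (Suc n) = X (k n + 1)" "\<xi> (n - 1) = X (k n - 1)"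
        using \<xi>_tail[of n] \<xi>_tail[of "Suc n"] \<xi>_tail[of "n - 1"] n kS by auto
      moreover from this have y: "y = Y (1 / k n)"
        unfolding y_def co Y_k[OF k1] by (simp add: algebra_simps)
      moreover have "0 \<le> 1 / k n" "1 / k n \<le> h0"
        using k_K[OF True] K by (auto simp: h0_def field_simps)
      moreover from this have "Y (1 / k n) \<ge> 0" using Yle[of 0 "1 / k n"] h0 Y_0 by simp
      ultimately show ?thesis using g0_Y[of "1 / k n"] G_k[OF k1] by (simp add: g_pos)
    next
      case False
      then have x: "\<xi> n = X K + e * (K * (K + 1) - k n * (k n + 1)) / 2"
        "\<xi> (Suc n) = X K + e * (K * (K + 1) - (k n + 1) * (k n + 2)) / 2"
        "\<xi> (n - 1) = X K + e * (K * (K + 1) - (k n - 1) * k n) / 2"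
        using \<xi>_early[of n] \<xi>_early[of "Suc n"] \<xi>_early[of "n - 1"] kS by auto
      have d: "\<xi> n - \<xi> (n - 1) = - (k n * e)" unfolding x by (simp add: field_simps)
      have "cd_coeff \<alpha> n * (\<xi> n - \<xi> (n - 1)) = - ((k n - \<alpha>) * e)"
        unfolding co d using k1 by (simp add: field_simps)
      then have y: "y = X K + e * (K * (K + 1) - k n * (k n + 1)) / 2 - (k n - \<alpha>) * e"
        unfolding y_def x by simp
      have step: "y - \<xi> (Suc n) = (\<alpha> + 1) * e" unfolding y x by (simp add: field_simps)
      have "y - Y1 = e * ((K - k n - 1) * (K + k n + 2)) / 2" unfolding y Y1_def by (simp add: field_simps)
      moreover have "k n + 1 \<le> K" using False by (simp add: k_def K_def)
      then have "0 \<le> e * ((K - k n - 1) * (K + k n + 2)) / 2" using e0 k1 K by simp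
      ultimately have yY1: "y \<ge> Y1" by simp
      have "Y1 \<ge> Y0" using Y1_Y0 e0 K by (smt (verit) mult_nonneg_nonneg)
      then have "L * (Y1 - Y0) \<le> L * (y - Y0)" "Y0 \<le> y" using yY1 L by auto
      then have "g y = \<Gamma>" using \<Gamma>(2) Y0 by (simp add: g_pos g0_hi)
      then show ?thesis using step s by (simp add: \<Gamma>_def)
    qed
    then show ?thesis by (simp add: y_def Let_def)
  qed
  show thesis
  proof (rule that[OF c Y0 _ g_odd g_lip _ _ rec])
    show "g 0 = 0" by (simp add: g_def)
  next
    fix a b assume ab: "0 < a" "a \<le> b" "b \<le> Y0"
    then show "g a / a powr (p - 1) \<le> g b / b powr (p - 1)"
      using Gm[of "\<phi> a" "\<phi> b"] \<phi>[of a] \<phi>[of b] \<phi>pos[of a] Yle[of "\<phi> a" "\<phi> b"] h0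
      by (simp add: g_ratio)
  next
    show "((\<lambda>y. g y / y powr (p - 1)) \<longlongrightarrow> c) (at_right 0)"
    proof (rule tendstoI)
      fix \<epsilon> :: real assume "\<epsilon> > 0"
      then have "\<forall>\<^sub>F h in at_right 0. dist (G h / Y h powr (p - 1)) c < \<epsilon>"
        using Gc by (rule tendstoD[rotated])
      then obtain b where b: "b > 0" "\<And>h. 0 < h \<Longrightarrow> h < b \<Longrightarrow> dist (G h / Y h powr (p - 1)) c < \<epsilon>"
        unfolding eventually_at_right_field by auto
      define m where "m = min b h0"
      have m: "0 < m" "m \<le> b" "m \<le> h0" using b h0 by (auto simp: m_def)
      have "dist (g y / y powr (p - 1)) c < \<epsilon>" if y: "0 < y" "y < Y m" for y
      proof -
        have yY0: "y \<le> Y0" using y Yle[of m h0] m h0 by (simp add: Y0_def)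
        have "\<phi> y < m" using \<phi>[of y] Yle[of m "\<phi> y"] y yY0 m by force
        then show ?thesis using b(2)[of "\<phi> y"] \<phi>pos[of y] y yY0 m by (simp add: g_ratio)
      qed
      moreover have "Y m > 0" using Ym[of 0 m] m h0 Y_0 by simp
      ultimately show "\<forall>\<^sub>F y in at_right 0. dist (g y / y powr (p - 1)) c < \<epsilon>"
        unfolding eventually_at_right_field by blast
    qed
  next
    show "\<forall>\<^sub>F n in sequentially. \<xi> n = (real n + \<alpha> - 1) powr (- \<theta>)"
      using eventually_ge_at_top[of n0] by eventually_elim (simp add: \<xi>_tail X_def k_def)
  qed
qed

section \<open>Potentials and separable functions\<close>

lemma continuous_has_antiderivative:
  fixes g :: "real \<Rightarrow> real"
  assumes "continuous_on UNIV g"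
  obtains f where "f 0 = 0" "\<And>y. (f has_real_derivative g y) (at y)"
proof (rule that[of "\<lambda>v. LBINT u=ereal 0..ereal v. g u"])
  show "(LBINT u=ereal 0..ereal 0. g u) = 0" by simp
next
  fix y :: real
  define b where "b = \<bar>y\<bar> + 1"
  have "((\<lambda>v. LBINT u=ereal 0..ereal v. g u) has_vector_derivative g y) (at y within {- b..b})"
    by (rule interval_integral_FTC2) (auto simp: b_def intro: continuous_on_subset[OF assms])
  moreover have "at y within {- b..b} = at y"
    by (rule at_within_interior) (auto simp: b_def)
  ultimately show "((\<lambda>v. LBINT u=ereal 0..ereal v. g u) has_real_derivative g y) (at y)"
    by (simp add: has_real_derivative_iff_has_vector_derivative)
qed

text \<open>For \<open>0 < x \<le> y \<le> Y0\<close> the monotone ratio bounds \<open>g x\<close> by \<open>g y / y powr (p - 1) * x powr (p - 1)\<close> from above and by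
\<open>c * x powr (p - 1)\<close> from below. Integration from \<open>0\<close> to \<open>y\<close> turns the first bound into the flatness condition and
the second one into the growth condition, and both together give the asymptotics at \<open>0\<close>.\<close>

lemma potential_of_odd_force:
  fixes g :: "real \<Rightarrow> real"
  assumes p: "p > 2" and c: "c > 0" and Y0: "Y0 > 0"
    and g0: "g 0 = 0" and odd: "\<And>y. g (- y) = - g y"
    and lip: "\<And>a b. a \<le> b \<Longrightarrow> g a \<le> g b \<and> g b - g a \<le> L * (b - a)"
    and ratio: "\<And>a b. 0 < a \<Longrightarrow> a \<le> b \<Longrightarrow> b \<le> Y0 \<Longrightarrow> g a / a powr (p - 1) \<le> g b / b powr (p - 1)"
    and lim: "((\<lambda>y. g y / y powr (p - 1)) \<longlongrightarrow> c) (at_right 0)"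
  obtains f where "f 0 = 0" "\<And>y. (f has_real_derivative g y) (at y)" "convex_on UNIV f"
    "\<And>y. f y \<ge> 0" "\<And>y. f y = 0 \<Longrightarrow> y = 0"
    "\<And>y. \<bar>y\<bar> \<le> Y0 \<Longrightarrow> p * f y \<le> y * g y"
    "\<And>y. \<bar>y\<bar> \<le> Y0 \<Longrightarrow> c / p * \<bar>y\<bar> powr p \<le> f y"
    "((\<lambda>y. f y / y powr p) \<longlongrightarrow> c / p) (at_right 0)"
    "\<And>y. g Y0 * (\<bar>y\<bar> - Y0) \<le> f y" "g Y0 > 0"
proof -
  have "L-lipschitz_on UNIV g"
  proof (rule lipschitz_onI)
    show "L \<ge> 0" using lip[of 0 1] by simp
    fix a b show "dist (g a) (g b) \<le> L * dist a b"
      using lip[of a b] lip[of b a] by (cases "a \<le> b") (auto simp: dist_real_def)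
  qed
  then have "continuous_on UNIV g" by (rule lipschitz_on_continuous_on)
  then obtain f where f0: "f 0 = 0" and df: "\<And>y. (f has_real_derivative g y) (at y)"
    using continuous_has_antiderivative by blast
  have conv: "convex_on UNIV f"
    by (rule convex_on_realI[OF connected_UNIV df]) (use lip in auto)
  have even: "f (- y) = f y" for y
  proof -
    have "((\<lambda>y. f (- y) - f y) has_real_derivative 0) (at y)" for y
    proof -
      have "((\<lambda>y. f (- y)) has_real_derivative g (- y) * (- 1)) (at y)"
        by (rule DERIV_chain2[OF df]) (auto intro!: derivative_eq_intros)
      then show ?thesis using DERIV_diff[OF _ df[of y]] by (fastforce simp: odd)
    qed
    then have "f (- y) - f y = f (- 0) - f 0"
      using DERIV_isconst_all[of "\<lambda>y. f (- y) - f y" y 0] by blast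
    then show ?thesis by simp
  qed
  have tangent: "f x + g x * (y - x) \<le> f y" for x y
    using convex_on_imp_above_tangent[OF conv, of x y "g x"] df[of x] by simp
  have r_ge: "c \<le> g y / y powr (p - 1)" if y: "0 < y" "y \<le> Y0" for y
  proof (rule tendsto_upperbound[OF lim])
    show "\<forall>\<^sub>F a in at_right 0. g a / a powr (p - 1) \<le> g y / y powr (p - 1)"
      unfolding eventually_at_right_field using ratio y by (intro exI[of _ y]) auto
  qed simp
  have g_ge: "c * y powr (p - 1) \<le> g y" if "0 < y" "y \<le> Y0" for y
    using r_ge[OF that] that by (simp add: pos_le_divide_eq)
  have dpow: "((\<lambda>y. a * y powr p / p) has_real_derivative a * y powr (p - 1)) (at y)" if "y > 0" for a y
  proof -
    have "((\<lambda>y. a * y powr p / p) has_real_derivative a * (p * y powr (p - 1)) / p) (at y)"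
      by (intro DERIV_cdivide DERIV_cmult has_real_derivative_powr that)
    then show ?thesis using p by simp
  qed
  have cont_pow: "continuous_on {0..y} (\<lambda>y. a * y powr p / p)" for a y
    using p by (intro continuous_intros continuous_on_powr') auto
  have contf: "continuous_on A f" for A
    using df by (auto intro!: continuous_at_imp_continuous_on DERIV_isCont)
  have f_ge: "c * y powr p / p \<le> f y" if y: "0 \<le> y" "y \<le> Y0" for y
  proof -
    have "f 0 - c * 0 powr p / p \<le> f y - c * y powr p / p"
    proof (rule DERIV_nonneg_imp_increasing_open[OF y(1)])
      fix x assume "0 < x" "x < y"
      then show "\<exists>D. DERIV (\<lambda>y. f y - c * y powr p / p) x :> D \<and> 0 \<le> D"
        using DERIV_diff[OF df[of x] dpow[of x c]] g_ge[of x] y by force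
    qed (intro continuous_intros contf cont_pow)
    then show ?thesis by (simp add: f0)
  qed
  have f_le: "f y \<le> (g y / y powr (p - 1)) * y powr p / p" if y: "0 < y" "y \<le> Y0" for y
  proof -
    define r where "r = g y / y powr (p - 1)"
    have "r * 0 powr p / p - f 0 \<le> r * y powr p / p - f y"
    proof (rule DERIV_nonneg_imp_increasing_open[where f = "\<lambda>y. r * y powr p / p - f y"])
      fix x assume x: "0 < x" "x < y"
      then have "g x \<le> r * x powr (p - 1)"
        using ratio[of x y] y by (simp add: r_def pos_divide_le_eq)
      then show "\<exists>D. DERIV (\<lambda>y. r * y powr p / p - f y) x :> D \<and> 0 \<le> D"
        using DERIV_diff[OF dpow[of x r] df[of x]] x by force
    qed (use y in \<open>auto intro!: continuous_intros contf cont_pow\<close>)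
    then show ?thesis by (simp add: f0 r_def)
  qed
  have H: "p * f y \<le> y * g y" if "0 \<le> y" "y \<le> Y0" for y
  proof (cases "y = 0")
    case False
    then have "y powr p = y powr (p - 1) * y" using that powr_add[of y "p - 1" 1] by simp
    then show ?thesis using f_le[of y] that False p by (simp add: field_simps)
  qed (simp add: f0)
  have gY0: "g Y0 > 0"
    using g_ge[of Y0] Y0 c by (smt (verit) powr_gt_zero mult_pos_pos)
  show thesis
  proof (rule that[OF f0 df conv])
    show nonneg: "f y \<ge> 0" for y using tangent[of 0 y] by (simp add: f0 g0)
    have pos: "f y > 0" if "y > 0" for y
    proof -
      \<comment> \<open>positivity is known on \<open>{0<..Y0}\<close> from the growth bound and spreads by monotonicity\<close>
      define m where "m = min y Y0"
      have m: "m > 0" "m \<le> y" "m \<le> Y0" using that Y0 by (auto simp: m_def)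
      have "0 < c * m powr p / p" using c m p by simp
      also have "\<dots> \<le> f m" using f_ge[of m] m by simp
      also have "f m \<le> f y"
      proof -
        have "g m \<ge> 0" using lip[of 0 m] m g0 by simp
        then have "g m * (y - m) \<ge> 0" using m by simp
        then show ?thesis using tangent[of m y] by linarith
      qed
      finally show ?thesis .
    qed
    show "f y = 0 \<Longrightarrow> y = 0" for y
      using pos[of y] pos[of "- y"] even[of y] by (cases y "0 :: real" rule: linorder_cases) auto
    show "p * f y \<le> y * g y" if "\<bar>y\<bar> \<le> Y0" for y
      using H[of y] H[of "- y"] that by (cases "y \<ge> 0") (auto simp: even odd)
    show "c / p * \<bar>y\<bar> powr p \<le> f y" if "\<bar>y\<bar> \<le> Y0" for y
      using f_ge[of "\<bar>y\<bar>"] that even[of y] by (cases "y \<ge> 0") (auto simp: abs_if)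
    show "g Y0 * (\<bar>y\<bar> - Y0) \<le> f y" for y
      using tangent[of Y0 "\<bar>y\<bar>"] nonneg[of Y0] even[of y] by (cases "y \<ge> 0") (auto simp: abs_if)
    show "((\<lambda>y. f y / y powr p) \<longlongrightarrow> c / p) (at_right 0)"
    proof (rule tendsto_sandwich)
      show "\<forall>\<^sub>F y in at_right 0. c / p \<le> f y / y powr p"
        unfolding eventually_at_right_field using f_ge Y0
        by (intro exI[of _ Y0]) (auto simp: pos_le_divide_eq)
      show "\<forall>\<^sub>F y in at_right 0. f y / y powr p \<le> g y / y powr (p - 1) / p"
        unfolding eventually_at_right_field using f_le Y0
        by (intro exI[of _ Y0]) (auto simp: pos_divide_le_eq)
      show "((\<lambda>y. g y / y powr (p - 1) / p) \<longlongrightarrow> c / p) (at_right 0)"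
        using lim p by (intro tendsto_intros) auto
    qed simp
  qed (fact gY0)
qed

lemma gradient_separable:
  fixes f g :: "real \<Rightarrow> real"
  assumes df: "\<And>y. (f has_real_derivative g y) (at y)"
  defines "F \<equiv> \<lambda>x :: real ^ 'n. \<Sum>i\<in>UNIV. f (x $ i)"
  shows "F differentiable (at x)" and "gradient F x = (\<chi> i. g (x $ i))"
proof -
  have "(F has_derivative (\<lambda>h. \<Sum>i\<in>UNIV. h $ i * g (x $ i))) (at x)"
    unfolding F_def
  proof (rule has_derivative_sum)
    fix i :: 'n
    have "((\<lambda>x :: real ^ 'n. x $ i) has_derivative (\<lambda>h. h $ i)) (at x)"
      by (rule bounded_linear_imp_has_derivative) (rule bounded_linear_vec_nth)
    from has_derivative_compose[OF this, of f "\<lambda>h. h * g (x $ i)"] df[of "x $ i"]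
    show "((\<lambda>x. f (x $ i)) has_derivative (\<lambda>h. h $ i * g (x $ i))) (at x)"
      by (simp add: has_field_derivative_def mult_commute_abs)
  qed
  then have "GDERIV F x :> (\<chi> i. g (x $ i))"
    by (simp add: gderiv_def inner_vec_def)
  then show "F differentiable (at x)" and "gradient F x = (\<chi> i. g (x $ i))"
    by (auto simp: gderiv_def differentiable_def intro: gradient_eqI)
qed

lemma ex_component_ge_mean:
  fixes x :: "real ^ 'n"
  shows "\<exists>i. norm x / CARD('n) \<le> \<bar>x $ i\<bar>"
proof (rule ccontr)
  assume "\<nexists>i. norm x / CARD('n) \<le> \<bar>x $ i\<bar>"
  then have "(\<Sum>i\<in>UNIV. \<bar>x $ i\<bar>) < (\<Sum>i\<in>(UNIV :: 'n set). norm x / CARD('n))"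
    by (intro sum_strict_mono) (auto simp: not_le)
  then show False using norm_le_l1_cart[of x] by simp
qed

lemma cd_orbit_on_axis:
  fixes F :: "real ^ 'n \<Rightarrow> real"
  assumes grad: "\<And>x. gradient F x = (\<chi> i. g (x $ i))" and g0: "g 0 = 0"
    and rec: "\<And>n. n \<ge> 1 \<Longrightarrow> let y = \<xi> n + cd_coeff \<alpha> n * (\<xi> n - \<xi> (n - 1)) in \<xi> (Suc n) = y - s * g y"
  shows "cd_orbit \<alpha> s F (axis k (\<xi> 0)) (axis k (\<xi> 1)) n = axis k (\<xi> n)"
proof (induction n rule: induct_nat_012)
  case (ge2 n)
  have "gradient F (axis k y) = axis k (g y)" for y
    using g0 by (simp add: grad axis_def vec_eq_iff)
  moreover have "axis k a + b *\<^sub>R (axis k a - axis k c) = axis k (a + b * (a - c))"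
    and "axis k a - s *\<^sub>R axis k c = axis k (a - s * c)" for a b c :: real
    by (simp_all add: axis_def vec_eq_iff)
  ultimately show ?case
    using ge2 rec[of "Suc n"] by (simp add: Let_def)
qed simp_all

section \<open>Sharpness of the rate\<close>

text \<open>The sum of a one-dimensional potential over the coordinates. All conditions are inherited coordinatewise,
and an orbit that starts on a coordinate axis stays there, since the force vanishes at \<open>0\<close>; it is the
prescribed orbit. Its values are asymptotic to \<open>c / p * (n powr (- \<theta>)) powr p\<close>, and \<open>\<theta> * p = 2 * p / (p - 2)\<close>.\<close>

lemma ex_cd_sharp_function:
  fixes \<alpha> p L s :: real
  assumes p: "p > 2" and \<alpha>: "\<alpha> > 1 + 2 / (p - 2)" and L: "L > 0" and s: "s > 0"
  shows "\<exists>(F :: real ^ 'n \<Rightarrow> real) x0 x1 D. coercive F \<and> convex_smooth L F \<and> minimizers F = {0} \<and>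
    (\<forall>\<beta>. 2 < \<beta> \<and> \<beta> \<le> p \<longrightarrow> cond_H \<beta> F 0) \<and> cond_L p F 0 \<and> D > 0 \<and>
    cd_gap \<alpha> s F x0 x1 \<sim>[sequentially] (\<lambda>n. D * cd_rate p n)"
proof -
  define \<theta> where "\<theta> = 2 / (p - 2)"
  have th0: "\<theta> > 0" using p by (simp add: \<theta>_def)
  obtain c Y0 :: real and g :: "real \<Rightarrow> real" and \<xi> :: "nat \<Rightarrow> real"
  where c: "c > 0" and Y0: "Y0 > 0" and g0: "g 0 = 0" and odd: "\<And>y. g (- y) = - g y"
    and lip: "\<And>a b. a \<le> b \<Longrightarrow> g a \<le> g b \<and> g b - g a \<le> L * (b - a)"
    and ratio: "\<And>a b. 0 < a \<Longrightarrow> a \<le> b \<Longrightarrow> b \<le> Y0 \<Longrightarrow> g a / a powr (p - 1) \<le> g b / b powr (p - 1)"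
    and lim: "((\<lambda>y. g y / y powr (p - 1)) \<longlongrightarrow> c) (at_right 0)"
    and rec: "\<And>n. n \<ge> 1 \<Longrightarrow> let y = \<xi> n + cd_coeff \<alpha> n * (\<xi> n - \<xi> (n - 1)) in \<xi> (Suc n) = y - s * g y"
    and \<xi>: "\<forall>\<^sub>F n in sequentially. \<xi> n = (real n + \<alpha> - 1) powr (- \<theta>)"
  proof (rule one_dimensional_inverse_design[OF p \<theta>_def \<alpha>[folded \<theta>_def] L s], goal_cases)
    case prems: (1 g \<xi> c Y0)
    show ?thesis by (rule that[of c Y0 g \<xi>]) (fact prems)+
  qed
  obtain f where f0: "f 0 = 0" and df: "\<And>y. (f has_real_derivative g y) (at y)" and conv: "convex_on UNIV f"
    and f_nonneg: "\<And>y. f y \<ge> 0" and f_zero: "\<And>y. f y = 0 \<Longrightarrow> y = 0"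
    and fH: "\<And>y. \<bar>y\<bar> \<le> Y0 \<Longrightarrow> p * f y \<le> y * g y"
    and fL: "\<And>y. \<bar>y\<bar> \<le> Y0 \<Longrightarrow> c / p * \<bar>y\<bar> powr p \<le> f y"
    and flim: "((\<lambda>y. f y / y powr p) \<longlongrightarrow> c / p) (at_right 0)"
    and fgrow: "\<And>y. g Y0 * (\<bar>y\<bar> - Y0) \<le> f y" and gY0: "g Y0 > 0"
  proof (rule potential_of_odd_force[OF p c Y0, where g = g and L = L], goal_cases)
    case prems: (6 f)
    show ?case by (rule that[of f]) (fact prems)+
  next
    case 1 show ?case by (fact g0)
  next
    case 2 show ?case by (fact odd)
  next
    case 3 then show ?case by (intro lip)
  next
    case 4 then show ?case by (intro ratio)
  next
    case 5 show ?case by (fact lim)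
  qed
  define F where "F x = (\<Sum>i\<in>UNIV. f (x $ i))" for x :: "real ^ 'n"
  have dF: "F differentiable (at x)" and grad: "gradient F x = (\<chi> i. g (x $ i))" for x
    using gradient_separable[OF df] unfolding F_def[abs_def] by auto
  have F_ge: "f (x $ i) \<le> F x" for x i
    unfolding F_def by (rule member_le_sum) (auto simp: f_nonneg)
  have F0: "F 0 = 0" by (simp add: F_def f0)
  have min: "minimizers F = {0}"
  proof -
    have "x = 0" if "\<forall>z. F x \<le> F z" for x
    proof -
      have "F x \<le> 0" using that F0 by metis
      then have "f (x $ i) = 0" for i using F_ge[of x i] f_nonneg[of "x $ i"] by linarith
      then show ?thesis using f_zero by (simp add: vec_eq_iff)
    qed
    moreover have "F 0 \<le> F z" for z unfolding F0 unfolding F_def by (intro sum_nonneg f_nonneg)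
    ultimately show ?thesis by (auto simp: minimizers_def)
  qed
  have mv: "min_value F = 0" using min_value_eq[of 0 F] by (simp add: min F0)
  have smooth: "convex_smooth L F"
    unfolding convex_smooth_def
  proof (intro conjI allI dF)
    show "convex_on UNIV F"
    proof (rule convex_onI)
      fix t :: real and x y :: "real ^ 'n" assume t: "0 < t" "t < 1"
      have "F ((1 - t) *\<^sub>R x + t *\<^sub>R y) \<le> (\<Sum>i\<in>UNIV. (1 - t) * f (x $ i) + t * f (y $ i))"
        unfolding F_def
      proof (rule sum_mono)
        fix i show "f (((1 - t) *\<^sub>R x + t *\<^sub>R y) $ i) \<le> (1 - t) * f (x $ i) + t * f (y $ i)"
          using convex_onD[OF conv, of t "x $ i" "y $ i"] t by simp
      qed
      then show "F ((1 - t) *\<^sub>R x + t *\<^sub>R y) \<le> (1 - t) * F x + t * F y"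
        by (simp add: F_def sum.distrib sum_distrib_left)
    qed simp
    show "L-lipschitz_on UNIV (gradient F)"
    proof (rule lipschitz_onI)
      fix x y :: "real ^ 'n"
      have "norm (gradient F x - gradient F y) \<le> norm (L *\<^sub>R (x - y))"
      proof (rule norm_le_componentwise_cart)
        fix i
        show "norm ((gradient F x - gradient F y) $ i) \<le> norm ((L *\<^sub>R (x - y)) $ i)"
          using lip[of "x $ i" "y $ i"] lip[of "y $ i" "x $ i"] L
          by (cases "x $ i \<le> y $ i") (auto simp: grad abs_mult)
      qed
      then show "dist (gradient F x) (gradient F y) \<le> L * dist x y"
        using L by (simp add: dist_norm)
    qed (use L in simp)
  qed
  have coerc: "coercive F"
    unfolding coercive_def
  proof (rule filterlim_at_top_mono)
    have "filterlim (\<lambda>t. g Y0 * (t / CARD('n) - Y0)) at_top at_top"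
      using gY0 by real_asymp
    then show "filterlim (\<lambda>x :: real ^ 'n. g Y0 * (norm x / CARD('n) - Y0)) at_top at_infinity"
      by (rule filterlim_compose[OF _ filterlim_norm_at_top])
    show "\<forall>\<^sub>F x :: real ^ 'n in at_infinity. g Y0 * (norm x / CARD('n) - Y0) \<le> F x"
    proof (intro always_eventually allI)
      fix x :: "real ^ 'n"
      obtain i where "norm x / CARD('n) \<le> \<bar>x $ i\<bar>" using ex_component_ge_mean[of x] by blast
      then have "g Y0 * (norm x / CARD('n) - Y0) \<le> g Y0 * (\<bar>x $ i\<bar> - Y0)"
        using gY0 by (intro mult_left_mono) auto
      also note fgrow
      also note F_ge
      finally show "g Y0 * (norm x / CARD('n) - Y0) \<le> F x" .
    qed
  qed
  have H: "cond_H \<beta> F 0" if \<beta>: "2 < \<beta>" "\<beta> \<le> p" for \<beta>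
    unfolding cond_H_def
  proof (intro exI[of _ Y0] conjI allI impI Y0)
    fix x :: "real ^ 'n" assume "norm (x - 0) \<le> Y0"
    then have "\<bar>x $ i\<bar> \<le> Y0" for i using component_le_norm_cart[of x i] by simp
    then have *: "\<beta> * f (x $ i) \<le> g (x $ i) * x $ i" for i
      using fH[of "x $ i"] mult_right_mono[OF \<beta>(2) f_nonneg[of "x $ i"]] by (simp add: mult.commute)
    have "\<beta> * F x \<le> (\<Sum>i\<in>UNIV. g (x $ i) * x $ i)"
      unfolding F_def sum_distrib_left by (intro sum_mono *)
    then show "F x - min_value F \<le> 1 / \<beta> * inner (gradient F x) (x - 0)"
      using \<beta> by (simp add: mv grad inner_vec_def field_simps)
  qed
  have Lc: "cond_L p F 0"
    unfolding cond_L_def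
  proof (rule exI[of _ "c / p * (1 / CARD('n)) powr p"], rule conjI[OF _ exI[of _ Y0]],
      goal_cases pos bound)
    case pos
    show "0 < c / p * (1 / real CARD('n)) powr p" using c p by simp
  next
    case bound
    show ?case
    proof (intro conjI allI impI Y0)
      fix x :: "real ^ 'n" assume x: "norm (x - 0) \<le> Y0"
      obtain i where i: "norm x / CARD('n) \<le> \<bar>x $ i\<bar>" using ex_component_ge_mean[of x] by blast
      have "c / p * (1 / real CARD('n)) powr p * norm (x - 0) powr p = c / p * (norm x / CARD('n)) powr p"
        by (simp add: powr_divide)
      also have "\<dots> \<le> c / p * \<bar>x $ i\<bar> powr p"
        using i c p by (intro mult_left_mono powr_mono2) auto
      also have "\<dots> \<le> f (x $ i)"
        using x component_le_norm_cart[of x i] by (intro fL) simp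
      also have "\<dots> \<le> F x" by (rule F_ge)
      finally show "c / p * (1 / real CARD('n)) powr p * norm (x - 0) powr p \<le> F x - min_value F"
        by (simp add: mv)
    qed
  qed
  obtain k :: 'n where True by blast
  have gap: "cd_gap \<alpha> s F (axis k (\<xi> 0)) (axis k (\<xi> 1)) n = f (\<xi> n)" for n
  proof -
    have "F (axis k y) = f y" for y
    proof -
      have "F (axis k y) = (\<Sum>i\<in>UNIV. if i = k then f y else 0)"
        unfolding F_def by (intro sum.cong) (auto simp: axis_def f0)
      then show ?thesis by simp
    qed
    then show ?thesis by (simp only: cd_gap_def cd_orbit_on_axis[OF grad g0 rec] mv diff_zero)
  qed
  have "cd_gap \<alpha> s F (axis k (\<xi> 0)) (axis k (\<xi> 1)) \<sim>[sequentially] (\<lambda>n. c / p * cd_rate p n)"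
  proof (rule asymp_equivI')
    define t where "t n = (real n + \<alpha> - 1) powr (- \<theta>)" for n :: nat
    have "filterlim t (at_right 0) sequentially"
      unfolding t_def using th0 by real_asymp
    then have 1: "(\<lambda>n. f (t n) / t n powr p) \<longlonglongrightarrow> c / p"
      by (rule filterlim_compose[OF flim])
    have 2: "(\<lambda>n. (real n + \<alpha> - 1) powr (- (\<theta> * p)) / real n powr (- (\<theta> * p))) \<longlonglongrightarrow> 1"
      by real_asymp
    have "(\<lambda>n. f (t n) / t n powr p / (c / p) *
        ((real n + \<alpha> - 1) powr (- (\<theta> * p)) / real n powr (- (\<theta> * p)))) \<longlonglongrightarrow> c / p / (c / p) * 1"
      using c p by (intro tendsto_mult tendsto_divide 1 2 tendsto_const) auto
    then have lim: "(\<lambda>n. f (t n) / t n powr p / (c / p) *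
        ((real n + \<alpha> - 1) powr (- (\<theta> * p)) / real n powr (- (\<theta> * p)))) \<longlonglongrightarrow> 1"
      using c p by simp
    show "(\<lambda>n. cd_gap \<alpha> s F (axis k (\<xi> 0)) (axis k (\<xi> 1)) n / (c / p * cd_rate p n)) \<longlonglongrightarrow> 1"
    proof (rule Lim_transform_eventually[OF lim])
      show "\<forall>\<^sub>F n in sequentially. f (t n) / t n powr p / (c / p) *
          ((real n + \<alpha> - 1) powr (- (\<theta> * p)) / real n powr (- (\<theta> * p)))
        = cd_gap \<alpha> s F (axis k (\<xi> 0)) (axis k (\<xi> 1)) n / (c / p * cd_rate p n)"
        using \<xi> eventually_ge_at_top[of 1]
      proof eventually_elim
        case (elim n)
        have pos: "real n + \<alpha> - 1 > 0" using \<alpha> th0 elim unfolding \<theta>_def by linarith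
        have "t n powr p = (real n + \<alpha> - 1) powr (- (\<theta> * p))"
          by (simp add: t_def powr_powr)
        moreover have "(real n + \<alpha> - 1) powr (- (\<theta> * p)) > 0" using pos by simp
        moreover have "cd_rate p n = real n powr (- (\<theta> * p))"
          by (simp add: cd_rate_def \<theta>_def)
        moreover have "\<xi> n = t n" using elim by (simp add: t_def)
        ultimately show ?case unfolding gap by (simp add: field_simps)
      qed
    qed
  qed
  moreover have "c / p > 0" using c p by simp
  ultimately show ?thesis using coerc smooth min H Lc by blast
qed

lemma no_gain_of_sharp_rate:
  assumes equiv: "a \<sim>[sequentially] (\<lambda>n. D * cd_rate p n)" and D: "D > 0"
    and G: "divergent_gain G"
  shows "a \<notin> O[sequentially](\<lambda>n. cd_rate p n / G n)"
proof
  assume "a \<in> O[sequentially](\<lambda>n. cd_rate p n / G n)"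
  moreover have "(\<lambda>n. D * cd_rate p n) \<in> O[sequentially](a)"
    by (rule bigthetaD1[OF asymp_equiv_imp_bigtheta[OF asymp_equiv_symI[OF equiv]]])
  ultimately have "(\<lambda>n. D * cd_rate p n) \<in> O[sequentially](\<lambda>n. cd_rate p n / G n)"
    by (rule landau_o.big_trans[rotated])
  then obtain C where "\<forall>\<^sub>F n in sequentially. norm (D * cd_rate p n) \<le> C * norm (cd_rate p n / G n)"
    by (rule landau_o.bigE)
  moreover have "\<forall>\<^sub>F n in sequentially. G n > C / D"
    using G by (simp add: divergent_gain_def filterlim_at_top_dense)
  ultimately have "\<forall>\<^sub>F n in sequentially. False"
    using eventually_gt_at_top[of 0]
  proof eventually_elim
    case (elim n)
    have r: "cd_rate p n > 0" using elim by (simp add: cd_rate_def)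
    have "G n > 0" using G by (simp add: divergent_gain_def)
    then have "D * G n \<le> C" using elim r D by (simp add: abs_mult field_simps)
    then show False using elim D by (simp add: field_simps)
  qed
  then show False by simp
qed

theorem theorem2:
  fixes \<alpha> L s p :: real
  assumes "\<alpha> > 3" and "L > 0" and "0 < s" and "s < inverse L" and "p > 2"
  shows
    "(\<forall>F :: real ^ 'n \<Rightarrow> real.
        (\<exists>\<beta>. 2 < \<beta> \<and> \<beta> \<le> p \<and> \<alpha> \<ge> (\<beta> + 2) / (\<beta> - 2) \<and> regime_unique L p \<beta> F) \<or>
        (regime_set L p F \<and> \<alpha> > 5 + 8 / (p - 2))
        \<longrightarrow> (\<forall>x0 x1. cd_gap \<alpha> s F x0 x1 \<in> O[sequentially](cd_rate p)))
     \<and> (\<forall>\<beta>. 2 < \<beta> \<and> \<beta> \<le> p \<and> \<alpha> \<ge> (\<beta> + 2) / (\<beta> - 2) \<longrightarrow>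
          (\<exists>(F :: real ^ 'n \<Rightarrow> real) x0 x1 D.
             coercive F \<and> regime_unique L p \<beta> F \<and> D > 0 \<and>
             cd_gap \<alpha> s F x0 x1 \<sim>[sequentially] (\<lambda>n. D * cd_rate p n)) \<and>
          \<not> (\<exists>G. divergent_gain G \<and>
               (\<forall>F :: real ^ 'n \<Rightarrow> real. regime_unique L p \<beta> F \<longrightarrow>
                  (\<forall>x0 x1. cd_gap \<alpha> s F x0 x1 \<in> O[sequentially](\<lambda>n. cd_rate p n / G n)))))
     \<and> (\<alpha> > 5 + 8 / (p - 2) \<longrightarrow>
          (\<exists>(F :: real ^ 'n \<Rightarrow> real) x0 x1 D.
             coercive F \<and> (\<exists>xs. minimizers F = {xs}) \<and> regime_set L p F \<and> D > 0 \<and>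
             cd_gap \<alpha> s F x0 x1 \<sim>[sequentially] (\<lambda>n. D * cd_rate p n)) \<and>
          \<not> (\<exists>G. divergent_gain G \<and>
               (\<forall>F :: real ^ 'n \<Rightarrow> real. regime_set L p F \<longrightarrow>
                  (\<forall>x0 x1. cd_gap \<alpha> s F x0 x1 \<in> O[sequentially](\<lambda>n. cd_rate p n / G n)))))"
proof -
  note p = \<open>p > 2\<close> and L = \<open>L > 0\<close> and s = \<open>0 < s\<close>
  have \<alpha>: "\<alpha> \<ge> 3" using \<open>\<alpha> > 3\<close> by simp
  have sL: "s * L \<le> 1" using \<open>s < inverse L\<close> L by (simp add: field_simps)
  have upper: "cd_gap \<alpha> s F x0 x1 \<in> O[sequentially](cd_rate p)"
    if "(\<exists>\<beta>. 2 < \<beta> \<and> \<beta> \<le> p \<and> \<alpha> \<ge> (\<beta> + 2) / (\<beta> - 2) \<and> regime_unique L p \<beta> F) \<or>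
        (regime_set L p F \<and> \<alpha> > 5 + 8 / (p - 2))" for F :: "real ^ 'n \<Rightarrow> real" and x0 x1
    using that cd_rate_regime_unique[OF _ _ _ _ \<alpha> s sL] cd_rate_regime_set[OF _ _ s sL p] by blast
  have sharp: "\<exists>(F :: real ^ 'n \<Rightarrow> real) x0 x1 D. coercive F \<and> convex_smooth L F \<and> minimizers F = {0} \<and>
      (\<forall>\<beta>. 2 < \<beta> \<and> \<beta> \<le> p \<longrightarrow> cond_H \<beta> F 0) \<and> cond_L p F 0 \<and> D > 0 \<and>
      cd_gap \<alpha> s F x0 x1 \<sim>[sequentially] (\<lambda>n. D * cd_rate p n)" if "\<alpha> > 1 + 2 / (p - 2)"
    by (rule ex_cd_sharp_function[OF p that L s])
  have sharp_unique: "\<exists>(F :: real ^ 'n \<Rightarrow> real) x0 x1 D. coercive F \<and> regime_unique L p \<beta> F \<and> D > 0 \<and>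
      cd_gap \<alpha> s F x0 x1 \<sim>[sequentially] (\<lambda>n. D * cd_rate p n)"
    if \<beta>: "2 < \<beta>" "\<beta> \<le> p" "\<alpha> \<ge> (\<beta> + 2) / (\<beta> - 2)" for \<beta>
  proof -
    have "2 / (p - 2) \<le> 2 / (\<beta> - 2)" "2 / (\<beta> - 2) > 0"
      using \<beta> by (auto intro: divide_left_mono)
    moreover have "(\<beta> + 2) / (\<beta> - 2) = 1 + 2 * (2 / (\<beta> - 2))" using \<beta> by (simp add: field_simps)
    ultimately have "\<alpha> > 1 + 2 / (p - 2)" using \<beta> by linarith
    from sharp[OF this] \<beta> show ?thesis unfolding regime_unique_def by blast
  qed
  have sharp_set: "\<exists>(F :: real ^ 'n \<Rightarrow> real) x0 x1 D. coercive F \<and> (\<exists>xs. minimizers F = {xs}) \<and>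
      regime_set L p F \<and> D > 0 \<and> cd_gap \<alpha> s F x0 x1 \<sim>[sequentially] (\<lambda>n. D * cd_rate p n)"
    if \<alpha>8: "\<alpha> > 5 + 8 / (p - 2)"
  proof -
    have "8 / (p - 2) = 4 * (2 / (p - 2))" "2 / (p - 2) > 0" using p by auto
    then have "\<alpha> > 1 + 2 / (p - 2)" using \<alpha>8 by linarith
    moreover have "cond_Lset p F" if "minimizers F = {0}" "cond_L p F 0" for F :: "real ^ 'n \<Rightarrow> real"
      using that by (simp add: cond_Lset_def cond_L_def)
    ultimately show ?thesis using sharp unfolding regime_set_def by blast
  qed
  show ?thesis
    using upper sharp_unique sharp_set no_gain_of_sharp_rate by meson
qed

end
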